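(* Let $(f_1,h_1),(f_2,h_2)\in \mathrm{LGen}(\omega)$. Then the Lie bracket $[X_{(f_1,h_1)},X_{(f_2,h_2)}]$ of their pre-Hamiltonian lifts is the pre-Hamiltonian lift $X_{(f,h)}$ of a pair of functions $(f,h)\in \mathrm{LGen}(\omega)$.
   Context: Everything is smooth. $M$ is a $(2n+1)$-dimensional manifold with a regular almost-cosymplectic-contact structure $(\omega,\Omega)$, i.e. a 1-form $\omega$ and a 2-form $\Omega$ with $d\Omega=0$ and $\omega\wedge\Omega^n$ nowhere zero. For a vector field $X$ put $\Omega^\flat(X)=i_X\Omega$. $(E,\Lambda)$ denotes the dual almost-coPoisson-Jacobi structure: the unique pair of a vector field $E$ and a skew-symmetric 2-vector field $\Lambda$ with $i_E\omega=1$, $i_E\Omega=0$, $i_\omega\Lambda=0$ and $(\Omega^\flat|_{\mathrm{Im}\,\Lambda^\sharp})^{-1}=\Lambda^\sharp|_{\mathrm{Im}\,\Omega^\flat}$, where $\Lambda^\sharp(\alpha)=\alpha^\sharp=i_\alpha\Lambda$ for a 1-form $\alpha$, i.e. $\beta(\alpha^\sharp)=\Lambda(\alpha,\beta)$. We write $df^\sharp=(df)^\sharp$. Convention: $d\omega(X,Y)=X\cdot\omega(Y)-Y\cdot\omega(X)-\omega([X,Y])$. The pre-Hamiltonian lift of a pair of functions $(f,h)$ is the vector field $X_{(f,h)}=df^\sharp+h\,E$. $\mathrm{LGen}(\omega)\subset C^\infty(M)\times C^\infty(M)$ is the subsheaf of pairs $(f,h)$ that (locally) generate infinitesimal symmetries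 of $\omega$, i.e. that satisfy $i_{df^\sharp}d\omega+h\,i_Ed\omega+dh=0$ (equivalently $L_{X_{(f,h)}}\omega=0$). *)

theory Defs
  imports "HOL-Analysis.Analysis" "HOL-Combinatorics.Permutations"
begin

section \<open>Smooth manifolds\<close>

text \<open>The following two notions are meant for open sets \<open>S\<close> only.\<close>

primrec Ck_on :: "nat \<Rightarrow> 'b::real_normed_vector set \<Rightarrow> ('b \<Rightarrow> 'c::real_normed_vector) \<Rightarrow> bool" where
  "Ck_on 0 S f \<longleftrightarrow> continuous_on S f"
| "Ck_on (Suc k) S f \<longleftrightarrow> (\<forall>x\<in>S. f differentiable (at x)) \<and>
     (\<forall>v. Ck_on k S (\<lambda>x. frechet_derivative f (at x) v))"

definition smooth_on :: "'b::real_normed_vector set \<Rightarrow> ('b \<Rightarrow> 'c::real_normed_vector) \<Rightarrow> bool" where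
  "smooth_on S f \<longleftrightarrow> (\<forall>k. Ck_on k S f)"

text \<open>A space with charts \<open>(U, \<phi>)\<close> modelled on the Euclidean space \<open>'b\<close>; its points are those
  of \<open>topspace (mtop M)\<close>. Values of maps outside of the set under consideration are irrelevant.\<close>

record ('a, 'b) charted_space =
  mtop :: "'a topology"
  charts :: "('a set \<times> ('a \<Rightarrow> 'b)) set"

definition smooth_manifold :: "('a, 'b::euclidean_space) charted_space \<Rightarrow> bool" where
  "smooth_manifold M \<longleftrightarrow>
     Hausdorff_space (mtop M) \<and> second_countable (mtop M) \<and>
     (\<Union>(U, \<phi>)\<in>charts M. U) = topspace (mtop M) \<and>
     (\<forall>(U, \<phi>)\<in>charts M. openin (mtop M) U \<and> open (\<phi> ` U) \<and>
        homeomorphic_map (subtopology (mtop M) U) (top_of_set (\<phi> ` U)) \<phi>) \<and>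
     (\<forall>(U, \<phi>)\<in>charts M. \<forall>(V, \<psi>)\<in>charts M.
        smooth_on (\<phi> ` (U \<inter> V)) (\<psi> \<circ> inv_into U \<phi>))"

definition smooth_fun :: "('a, 'b::euclidean_space) charted_space \<Rightarrow> 'a set \<Rightarrow> ('a \<Rightarrow> real) \<Rightarrow> bool" where
  "smooth_fun M U f \<longleftrightarrow> openin (mtop M) U \<and>
     (\<forall>(V, \<phi>)\<in>charts M. smooth_on (\<phi> ` (U \<inter> V)) (f \<circ> inv_into V \<phi>))"

definition smooth_near :: "('a, 'b::euclidean_space) charted_space \<Rightarrow> 'a \<Rightarrow> ('a \<Rightarrow> real) \<Rightarrow> bool" where
  "smooth_near M p f \<longleftrightarrow> (\<exists>U. p \<in> U \<and> smooth_fun M U f)"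

section \<open>Tangent and cotangent spaces, tensor fields\<close>

text \<open>Tangent vectors at \<open>p\<close> are the derivations of the germs at \<open>p\<close> of smooth functions. Being
  HOL functions, they must also be given a value at functions that are not smooth near \<open>p\<close>;
  this value is fixed to be 0.\<close>

type_synonym 'a tvec = "('a \<Rightarrow> real) \<Rightarrow> real"
type_synonym 'a covec = "'a tvec \<Rightarrow> real"

definition tangent :: "('a, 'b::euclidean_space) charted_space \<Rightarrow> 'a \<Rightarrow> 'a tvec set" where
  "tangent M p = {v.
     (\<forall>f g a b. smooth_near M p f \<longrightarrow> smooth_near M p g \<longrightarrow>
        v (\<lambda>x. a * f x + b * g x) = a * v f + b * v g) \<and>
     (\<forall>f g. smooth_near M p f \<longrightarrow> smooth_near M p g \<longrightarrow>
        v (\<lambda>x. f x * g x) = f p * v g + g p * v f) \<and>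
     (\<forall>f g U. smooth_near M p f \<longrightarrow> smooth_near M p g \<longrightarrow>
        openin (mtop M) U \<longrightarrow> p \<in> U \<longrightarrow> (\<forall>x\<in>U. f x = g x) \<longrightarrow> v f = v g) \<and>
     (\<forall>f. \<not> smooth_near M p f \<longrightarrow> v f = 0)}"

definition linear_fiber :: "('c \<Rightarrow> real) set \<Rightarrow> (('c \<Rightarrow> real) \<Rightarrow> real) \<Rightarrow> bool" where
  "linear_fiber S \<alpha> \<longleftrightarrow>
     (\<forall>u\<in>S. \<forall>v\<in>S. \<forall>a b. \<alpha> (\<lambda>x. a * u x + b * v x) = a * \<alpha> u + b * \<alpha> v)"

definition cotangent :: "('a, 'b::euclidean_space) charted_space \<Rightarrow> 'a \<Rightarrow> 'a covec set" where
  "cotangent M p = {\<alpha>. linear_fiber (tangent M p) \<alpha> \<and> (\<forall>v. v \<notin> tangent M p \<longrightarrow> \<alpha> v = 0)}"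

definition differential ::
    "('a, 'b::euclidean_space) charted_space \<Rightarrow> ('a \<Rightarrow> real) \<Rightarrow> 'a \<Rightarrow> 'a covec" where
  "differential M f p = (\<lambda>v. if v \<in> tangent M p then v f else 0)"

definition vector_field ::
    "('a, 'b::euclidean_space) charted_space \<Rightarrow> 'a set \<Rightarrow> ('a \<Rightarrow> 'a tvec) \<Rightarrow> bool" where
  "vector_field M U X \<longleftrightarrow> openin (mtop M) U \<and> (\<forall>p\<in>U. X p \<in> tangent M p) \<and>
     (\<forall>V f. V \<subseteq> U \<longrightarrow> smooth_fun M V f \<longrightarrow> smooth_fun M V (\<lambda>p. X p f))"

text \<open>Smoothness of a covariant tensor field is tested on local vector fields, and smoothness of a
  contravariant one on local 1-forms.\<close>

definition one_form ::
    "('a, 'b::euclidean_space) charted_space \<Rightarrow> 'a set \<Rightarrow> ('a \<Rightarrow> 'a covec) \<Rightarrow> bool" where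
  "one_form M U \<omega> \<longleftrightarrow> openin (mtop M) U \<and> (\<forall>p\<in>U. \<omega> p \<in> cotangent M p) \<and>
     (\<forall>V X. V \<subseteq> U \<longrightarrow> vector_field M V X \<longrightarrow> smooth_fun M V (\<lambda>p. \<omega> p (X p)))"

definition two_form ::
    "('a, 'b::euclidean_space) charted_space \<Rightarrow> 'a set \<Rightarrow> ('a \<Rightarrow> 'a tvec \<Rightarrow> 'a tvec \<Rightarrow> real) \<Rightarrow> bool" where
  "two_form M U \<Omega> \<longleftrightarrow> openin (mtop M) U \<and>
     (\<forall>p\<in>U. \<forall>u\<in>tangent M p. linear_fiber (tangent M p) (\<Omega> p u)) \<and>
     (\<forall>p\<in>U. \<forall>u\<in>tangent M p. \<forall>v\<in>tangent M p. \<Omega> p u v = - \<Omega> p v u) \<and>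
     (\<forall>V X Y. V \<subseteq> U \<longrightarrow> vector_field M V X \<longrightarrow> vector_field M V Y \<longrightarrow>
        smooth_fun M V (\<lambda>p. \<Omega> p (X p) (Y p)))"

text \<open>A skew-symmetric 2-vector at \<open>p\<close> is a skew-symmetric bilinear form on the cotangent space.\<close>

definition two_vector_field ::
    "('a, 'b::euclidean_space) charted_space \<Rightarrow> 'a set \<Rightarrow> ('a \<Rightarrow> 'a covec \<Rightarrow> 'a covec \<Rightarrow> real) \<Rightarrow> bool" where
  "two_vector_field M U \<Lambda> \<longleftrightarrow> openin (mtop M) U \<and>
     (\<forall>p\<in>U. \<forall>\<alpha>\<in>cotangent M p. linear_fiber (cotangent M p) (\<Lambda> p \<alpha>)) \<and>
     (\<forall>p\<in>U. \<forall>\<alpha>\<in>cotangent M p. \<forall>\<beta>\<in>cotangent M p. \<Lambda> p \<alpha> \<beta> = - \<Lambda> p \<beta> \<alpha>) \<and>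
     (\<forall>V \<alpha> \<beta>. V \<subseteq> U \<longrightarrow> one_form M V \<alpha> \<longrightarrow> one_form M V \<beta> \<longrightarrow>
        smooth_fun M V (\<lambda>p. \<Lambda> p (\<alpha> p) (\<beta> p)))"

definition lie_bracket ::
    "('a, 'b::euclidean_space) charted_space \<Rightarrow> ('a \<Rightarrow> 'a tvec) \<Rightarrow> ('a \<Rightarrow> 'a tvec) \<Rightarrow> 'a \<Rightarrow> 'a tvec" where
  "lie_bracket M X Y p =
     (\<lambda>f. if smooth_near M p f then X p (\<lambda>q. Y q f) - Y p (\<lambda>q. X q f) else 0)"

text \<open>Exterior derivatives of 1-forms and 2-forms, evaluated on vector fields. The convention is
  the one without the factors 1/2 and 1/3.\<close>

definition d_one_form :: "('a, 'b::euclidean_space) charted_space \<Rightarrow> ('a \<Rightarrow> 'a covec) \<Rightarrow>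
    ('a \<Rightarrow> 'a tvec) \<Rightarrow> ('a \<Rightarrow> 'a tvec) \<Rightarrow> 'a \<Rightarrow> real" where
  "d_one_form M \<omega> X Y p =
     X p (\<lambda>q. \<omega> q (Y q)) - Y p (\<lambda>q. \<omega> q (X q)) - \<omega> p (lie_bracket M X Y p)"

definition d_two_form :: "('a, 'b::euclidean_space) charted_space \<Rightarrow> ('a \<Rightarrow> 'a tvec \<Rightarrow> 'a tvec \<Rightarrow> real) \<Rightarrow>
    ('a \<Rightarrow> 'a tvec) \<Rightarrow> ('a \<Rightarrow> 'a tvec) \<Rightarrow> ('a \<Rightarrow> 'a tvec) \<Rightarrow> 'a \<Rightarrow> real" where
  "d_two_form M \<Omega> X Y Z p =
     X p (\<lambda>q. \<Omega> q (Y q) (Z q)) - Y p (\<lambda>q. \<Omega> q (X q) (Z q)) + Z p (\<lambda>q. \<Omega> q (X q) (Y q))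
     - \<Omega> p (lie_bracket M X Y p) (Z p) + \<Omega> p (lie_bracket M X Z p) (Y p)
     - \<Omega> p (lie_bracket M Y Z p) (X p)"

definition closed_two_form ::
    "('a, 'b::euclidean_space) charted_space \<Rightarrow> ('a \<Rightarrow> 'a tvec \<Rightarrow> 'a tvec \<Rightarrow> real) \<Rightarrow> bool" where
  "closed_two_form M \<Omega> \<longleftrightarrow>
     (\<forall>U X Y Z. vector_field M U X \<longrightarrow> vector_field M U Y \<longrightarrow> vector_field M U Z \<longrightarrow>
        (\<forall>p\<in>U. d_two_form M \<Omega> X Y Z p = 0))"

section \<open>Exterior products at a point\<close>

text \<open>An alternating \<open>k\<close>-form takes its arguments as a sequence, of which only the entries
  \<open>0, \<dots>, k - 1\<close> matter.\<close>

definition wedge :: "nat \<Rightarrow> nat \<Rightarrow> ((nat \<Rightarrow> 'v) \<Rightarrow> real) \<Rightarrow> ((nat \<Rightarrow> 'v) \<Rightarrow> real) \<Rightarrow> (nat \<Rightarrow> 'v) \<Rightarrow> real" where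
  "wedge k l \<alpha> \<beta> = (\<lambda>v. (\<Sum>\<sigma> | \<sigma> permutes {..<k + l}.
     of_int (sign \<sigma>) * \<alpha> (\<lambda>i. v (\<sigma> i)) * \<beta> (\<lambda>i. v (\<sigma> (k + i)))) / (fact k * fact l))"

primrec wedge_power :: "('v \<Rightarrow> 'v \<Rightarrow> real) \<Rightarrow> nat \<Rightarrow> (nat \<Rightarrow> 'v) \<Rightarrow> real" where
  "wedge_power \<Omega> 0 = (\<lambda>v. 1)"
| "wedge_power \<Omega> (Suc n) = wedge 2 (2 * n) (\<lambda>v. \<Omega> (v 0) (v 1)) (wedge_power \<Omega> n)"

section \<open>Almost-cosymplectic-contact structures and their duals\<close>

definition acc_structure :: "('a, 'b::euclidean_space) charted_space \<Rightarrow> nat \<Rightarrow> ('a \<Rightarrow> 'a covec) \<Rightarrow>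
    ('a \<Rightarrow> 'a tvec \<Rightarrow> 'a tvec \<Rightarrow> real) \<Rightarrow> bool" where
  "acc_structure M n \<omega> \<Omega> \<longleftrightarrow>
     one_form M (topspace (mtop M)) \<omega> \<and> two_form M (topspace (mtop M)) \<Omega> \<and>
     closed_two_form M \<Omega> \<and>
     (\<forall>p\<in>topspace (mtop M). \<exists>v. (\<forall>i<2 * n + 1. v i \<in> tangent M p) \<and>
        wedge 1 (2 * n) (\<lambda>v. \<omega> p (v 0)) (wedge_power (\<Omega> p) n) v \<noteq> 0)"

definition flat :: "('a, 'b::euclidean_space) charted_space \<Rightarrow> ('a \<Rightarrow> 'a tvec \<Rightarrow> 'a tvec \<Rightarrow> real) \<Rightarrow>
    'a \<Rightarrow> 'a tvec \<Rightarrow> 'a covec" where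
  "flat M \<Omega> p u = (\<lambda>v. if v \<in> tangent M p then \<Omega> p u v else 0)"

text \<open>The tangent vector \<open>i\<^sub>\<alpha>\<Lambda>\<close>, determined through its pairing with all covectors.\<close>

definition sharp :: "('a, 'b::euclidean_space) charted_space \<Rightarrow> ('a \<Rightarrow> 'a covec \<Rightarrow> 'a covec \<Rightarrow> real) \<Rightarrow>
    'a \<Rightarrow> 'a covec \<Rightarrow> 'a tvec" where
  "sharp M \<Lambda> p \<alpha> = (THE v. v \<in> tangent M p \<and> (\<forall>\<beta>\<in>cotangent M p. \<beta> v = \<Lambda> p \<alpha> \<beta>))"

definition dual_structure :: "('a, 'b::euclidean_space) charted_space \<Rightarrow> ('a \<Rightarrow> 'a covec) \<Rightarrow>
    ('a \<Rightarrow> 'a tvec \<Rightarrow> 'a tvec \<Rightarrow> real) \<Rightarrow> ('a \<Rightarrow> 'a tvec) \<Rightarrow>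
    ('a \<Rightarrow> 'a covec \<Rightarrow> 'a covec \<Rightarrow> real) \<Rightarrow> bool" where
  "dual_structure M \<omega> \<Omega> E \<Lambda> \<longleftrightarrow>
     vector_field M (topspace (mtop M)) E \<and> two_vector_field M (topspace (mtop M)) \<Lambda> \<and>
     (\<forall>p\<in>topspace (mtop M).
        \<omega> p (E p) = 1 \<and>
        flat M \<Omega> p (E p) = (\<lambda>v. 0) \<and>
        sharp M \<Lambda> p (\<omega> p) = (\<lambda>f. 0) \<and>
        (let im_sharp = sharp M \<Lambda> p ` cotangent M p; im_flat = flat M \<Omega> p ` tangent M p in
           bij_betw (flat M \<Omega> p) im_sharp im_flat \<and>
           (\<forall>\<alpha>\<in>im_flat. the_inv_into im_sharp (flat M \<Omega> p) \<alpha> = sharp M \<Lambda> p \<alpha>)))"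

definition ham_field :: "('a, 'b::euclidean_space) charted_space \<Rightarrow>
    ('a \<Rightarrow> 'a covec \<Rightarrow> 'a covec \<Rightarrow> real) \<Rightarrow> ('a \<Rightarrow> real) \<Rightarrow> 'a \<Rightarrow> 'a tvec" where
  "ham_field M \<Lambda> f p = sharp M \<Lambda> p (differential M f p)"

definition preham_lift :: "('a, 'b::euclidean_space) charted_space \<Rightarrow> ('a \<Rightarrow> 'a tvec) \<Rightarrow>
    ('a \<Rightarrow> 'a covec \<Rightarrow> 'a covec \<Rightarrow> real) \<Rightarrow> ('a \<Rightarrow> real) \<times> ('a \<Rightarrow> real) \<Rightarrow> 'a \<Rightarrow> 'a tvec" where
  "preham_lift M E \<Lambda> = (\<lambda>(f, h) p. (\<lambda>g. ham_field M \<Lambda> f p g + h p * E p g))"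

text \<open>The sections of the sheaf \<open>LGen(\<omega>)\<close> over the open set \<open>U\<close>. The equality of 1-forms
  \<open>i\<^sub>X d\<omega> + h i\<^sub>E d\<omega> + dh = 0\<close>, where \<open>X\<close> is the field \<open>ham_field M \<Lambda> f\<close>, is expressed by
  evaluation on all local vector fields \<open>Y\<close>.\<close>

definition LGen :: "('a, 'b::euclidean_space) charted_space \<Rightarrow> ('a \<Rightarrow> 'a covec) \<Rightarrow> ('a \<Rightarrow> 'a tvec) \<Rightarrow>
    ('a \<Rightarrow> 'a covec \<Rightarrow> 'a covec \<Rightarrow> real) \<Rightarrow> 'a set \<Rightarrow> (('a \<Rightarrow> real) \<times> ('a \<Rightarrow> real)) set" where
  "LGen M \<omega> E \<Lambda> U = {(f, h). smooth_fun M U f \<and> smooth_fun M U h \<and>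
     (\<forall>V Y. V \<subseteq> U \<longrightarrow> vector_field M V Y \<longrightarrow>
        (\<forall>p\<in>V. d_one_form M \<omega> (ham_field M \<Lambda> f) Y p + h p * d_one_form M \<omega> E Y p
           + differential M h p (Y p) = 0))}"

end

theory Submission
  imports Defs
begin

text \<open>
  Put \<open>X\<^sub>i = df\<^sub>i\<^sup>\<sharp> + h\<^sub>i E\<close> and \<open>Z = [X\<^sub>1, X\<^sub>2]\<close>. The theorem holds with
  \<open>f = X\<^sub>1 \<cdot> f\<^sub>2 - h\<^sub>2 (E \<cdot> f\<^sub>1)\<close> and \<open>h = \<omega>(Z)\<close>. There are three ingredients.

  A pointwise one: the forms \<open>\<omega>\<close> and \<open>\<Omega>\<close> have no common degenerate direction, as otherwise
  \<open>\<omega> \<and> \<Omega>\<^sup>n\<close> would vanish (\<open>nondegenerate_pair\<close>). Thus a vector \<open>u\<close> is determined by \<open>\<omega>(u)\<close> and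
  \<open>i\<^sub>u \<Omega>\<close>, and the duality of the two structures gives \<open>i\<^sub>X \<Omega> = df - (E \<cdot> f) \<omega>\<close> and \<open>\<omega>(X) = h\<close>
  for the lift \<open>X\<close> of any pair \<open>(f, h)\<close> (\<open>Omega_preham_lift\<close>, \<open>omega_preham_lift\<close>).

  Cartan calculus: membership in \<open>LGen\<close> means that \<open>\<omega>\<close> is invariant under the lift (\<open>LGen_iff\<close>).
  With \<open>d\<Omega> = 0\<close> this invariance yields \<open>i\<^sub>Z \<Omega> = df + c \<omega>\<close> for some function \<open>c\<close>
  (\<open>Omega_lie_bracket\<close>). Evaluation on \<open>E\<close> shows \<open>c = - E \<cdot> f\<close>, so \<open>Z\<close> and the lift of \<open>(f, h)\<close> have
  the same contractions with \<open>\<omega>\<close> and \<open>\<Omega>\<close> and therefore coincide. Finally \<open>Z\<close>, as a commutator of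
  infinitesimal symmetries of \<open>\<omega>\<close>, is again one, i.e. \<open>(f, h)\<close> lies in \<open>LGen\<close>.

  Foundations: tangent vectors are derivations, so their space is known to be finite-dimensional
  only through Hadamard's lemma (\<open>tangent_eq_coord_vec\<close>). Finite dimension is what makes \<open>\<alpha>\<^sup>\<sharp>\<close>
  well defined (\<open>tangent_reflexive\<close>) and turns the condition on \<open>\<omega> \<and> \<Omega>\<^sup>n\<close> into nondegeneracy; the
  description in coordinates extends tangent vectors to local fields (\<open>tangent_vector_extends\<close>).
\<close>

section \<open>Functions of class C^k on open subsets of normed spaces\<close>

lemma linear_Basis_expansion:
  fixes L :: "'b::euclidean_space \<Rightarrow> 'c::real_vector"
  assumes "linear L"
  shows "L v = (\<Sum>b\<in>Basis. (v \<bullet> b) *\<^sub>R L b)"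
proof -
  have "L (\<Sum>b\<in>Basis. (v \<bullet> b) *\<^sub>R b) = (\<Sum>b\<in>Basis. (v \<bullet> b) *\<^sub>R L b)"
    using assms by (simp only: linear_sum linear_cmul)
  then show ?thesis by (simp only: euclidean_representation)
qed

lemma Ck_on_Suc_has_derivative:
  "Ck_on (Suc k) S f \<Longrightarrow> x \<in> S \<Longrightarrow> (f has_derivative frechet_derivative f (at x)) (at x)"
  using frechet_derivative_works by auto

lemma Ck_on_cong:
  assumes "open S" "\<forall>x\<in>S. f x = g x" "Ck_on k S f"
  shows "Ck_on k S g"
  using assms
proof (induction k arbitrary: f g)
  case 0
  then show ?case by (simp cong: continuous_on_cong_simp)
next
  case (Suc k)
  have D: "(g has_derivative frechet_derivative f (at x)) (at x)" if "x \<in> S" for x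
    using has_derivative_transform_within_open[OF Ck_on_Suc_has_derivative[OF Suc.prems(3) that]
        Suc.prems(1) that] Suc.prems(2) by blast
  then have "\<forall>x\<in>S. frechet_derivative f (at x) v = frechet_derivative g (at x) v" for v
    using frechet_derivative_at by metis
  then have "Ck_on k S (\<lambda>x. frechet_derivative g (at x) v)" for v
    using Suc.IH[OF Suc.prems(1), of "\<lambda>x. frechet_derivative f (at x) v"] Suc.prems(3) by simp
  with D show ?case
    by (auto simp: differentiable_def)
qed

text \<open>For use with the differentiation rules, which produce a formula \<open>f'\<close> for the derivative.\<close>

lemma Ck_on_Suc:
  assumes "open S"
    and D: "\<And>x. x \<in> S \<Longrightarrow> (f has_derivative f' x) (at x)"
    and C: "\<And>v. Ck_on k S (\<lambda>x. f' x v)"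
  shows "Ck_on (Suc k) S f"
proof -
  have "\<forall>x\<in>S. f' x v = frechet_derivative f (at x) v" for v
    using D frechet_derivative_at by metis
  then have "Ck_on k S (\<lambda>x. frechet_derivative f (at x) v)" for v
    by (rule Ck_on_cong[OF assms(1) _ C[of v]])
  then show ?thesis
    using D by (auto simp: differentiable_def)
qed

lemma Ck_on_subset: "Ck_on k S f \<Longrightarrow> T \<subseteq> S \<Longrightarrow> Ck_on k T f"
  by (induction k arbitrary: f) (auto intro: continuous_on_subset)

lemma Ck_on_SucD: "Ck_on (Suc k) S f \<Longrightarrow> Ck_on k S f"
proof (induction k arbitrary: f)
  case 0
  then show ?case
    using differentiable_imp_continuous_within
    by (force intro!: continuous_at_imp_continuous_on)
next
  case (Suc k)
  then have "\<forall>x\<in>S. f differentiable at x" "\<forall>v. Ck_on (Suc k) S (\<lambda>x. frechet_derivative f (at x) v)"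
    by (metis Ck_on.simps(2))+
  then show ?case using Suc.IH by simp
qed

lemma Ck_on_const: "Ck_on k S (\<lambda>x. c)"
  by (induction k arbitrary: c) (auto)

lemma Ck_on_bounded_linear:
  assumes "open S" "bounded_linear L" "Ck_on k S f"
  shows "Ck_on k S (\<lambda>x. L (f x))"
  using assms(3)
proof (induction k arbitrary: f)
  case 0
  then show ?case
    using assms(2) by (simp add: linear_continuous_on_compose bounded_linear.continuous_on)
next
  case (Suc k)
  show ?case
    using Suc.prems Suc.IH Ck_on_Suc_has_derivative[OF Suc.prems] assms(1)
    by (intro Ck_on_Suc[where f' = "\<lambda>x v. L (frechet_derivative f (at x) v)"])
       (auto intro: bounded_linear.has_derivative[OF assms(2)])
qed

lemma Ck_on_add:
  assumes "open S" "Ck_on k S f" "Ck_on k S g"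
  shows "Ck_on k S (\<lambda>x. f x + g x)"
  using assms(2,3)
proof (induction k arbitrary: f g)
  case 0
  then show ?case by (auto intro: continuous_intros)
next
  case (Suc k)
  show ?case
    using Suc Ck_on_Suc_has_derivative[OF Suc.prems(1)] Ck_on_Suc_has_derivative[OF Suc.prems(2)] assms(1)
    by (intro Ck_on_Suc[where f' = "\<lambda>x v. frechet_derivative f (at x) v + frechet_derivative g (at x) v"])
       (auto intro: has_derivative_add)
qed

lemma Ck_on_scaleR:
  fixes f :: "'b::real_normed_vector \<Rightarrow> real"
  assumes "open S" "Ck_on k S f" "Ck_on k S g"
  shows "Ck_on k S (\<lambda>x. f x *\<^sub>R g x)"
  using assms(2,3)
proof (induction k arbitrary: f g)
  case 0
  then show ?case by (auto intro: continuous_intros)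
next
  case (Suc k)
  have "Ck_on k S f" "Ck_on k S g"
    using Suc.prems Ck_on_SucD by blast+
  then have "Ck_on k S (\<lambda>x. f x *\<^sub>R frechet_derivative g (at x) v + frechet_derivative f (at x) v *\<^sub>R g x)" for v
    using Suc assms(1) by (intro Ck_on_add) auto
  then show ?case
    using Ck_on_Suc_has_derivative[OF Suc.prems(1)] Ck_on_Suc_has_derivative[OF Suc.prems(2)] assms(1)
    by (intro Ck_on_Suc[where f' = "\<lambda>x v. f x *\<^sub>R frechet_derivative g (at x) v
          + frechet_derivative f (at x) v *\<^sub>R g x"]) (auto intro: has_derivative_scaleR)
qed

lemma Ck_on_sum:
  assumes "open S" "finite I" "\<And>i. i \<in> I \<Longrightarrow> Ck_on k S (f i)"
  shows "Ck_on k S (\<lambda>x. \<Sum>i\<in>I. f i x)"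
  using assms(2,3)
  by (induction I rule: finite_induct) (auto intro: Ck_on_add Ck_on_const assms(1))

text \<open>By the chain rule the derivative of a composite in a direction \<open>v\<close> is a sum of products
  of functions of class C^k, the first factor being a coordinate of the inner derivative.\<close>

lemma Ck_on_compose:
  fixes g :: "'b::real_normed_vector \<Rightarrow> 'c::euclidean_space"
  assumes "open S" "open T" "g ` S \<subseteq> T" "Ck_on k S g" "Ck_on k T f"
  shows "Ck_on k S (f \<circ> g)"
  using assms(4,5)
proof (induction k arbitrary: f)
  case 0
  then show ?case
    using assms(3) continuous_on_compose continuous_on_subset by (metis Ck_on.simps(1))
next
  case (Suc k)
  let ?D = "\<lambda>x v. \<Sum>b\<in>Basis. (frechet_derivative g (at x) v \<bullet> b) *\<^sub>R frechet_derivative f (at (g x)) b"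
  have gk: "Ck_on k S g" using Suc.prems Ck_on_SucD by blast
  have "Ck_on k S (\<lambda>x. frechet_derivative f (at (g x)) b)" for b
    using Suc.IH[OF gk, of "\<lambda>y. frechet_derivative f (at y) b"] Suc.prems(2) by (simp add: o_def)
  then have C: "Ck_on k S (\<lambda>x. ?D x v)" for v
    using Suc.prems(1) assms(1)
    by (intro Ck_on_sum Ck_on_scaleR Ck_on_bounded_linear[OF _ bounded_linear_inner_left]) auto
  have D: "(f \<circ> g has_derivative ?D x) (at x)" if "x \<in> S" for x
  proof -
    have f: "(f has_derivative frechet_derivative f (at (g x))) (at (g x))"
      using Ck_on_Suc_has_derivative[OF Suc.prems(2)] that assms(3) by blast
    then have "linear (frechet_derivative f (at (g x)))"
      using has_derivative_linear by blast
    then have "frechet_derivative f (at (g x)) \<circ> frechet_derivative g (at x) = ?D x"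
      unfolding o_def by (intro ext linear_Basis_expansion)
    then show ?thesis
      using diff_chain_at[OF Ck_on_Suc_has_derivative[OF Suc.prems(1) that] f] by simp
  qed
  show ?case
    using Ck_on_Suc[OF assms(1) D C] .
qed

lemma smooth_on_compose:
  fixes g :: "'b::real_normed_vector \<Rightarrow> 'c::euclidean_space"
  assumes "open S" "open T" "g ` S \<subseteq> T" "smooth_on S g" "smooth_on T f"
  shows "smooth_on S (f \<circ> g)"
  using assms Ck_on_compose unfolding smooth_on_def by blast

lemma smooth_on_cong: "open S \<Longrightarrow> (\<And>x. x \<in> S \<Longrightarrow> f x = g x) \<Longrightarrow> smooth_on S f \<Longrightarrow> smooth_on S g"
  unfolding smooth_on_def using Ck_on_cong by blast

lemma smooth_on_subset: "smooth_on S f \<Longrightarrow> T \<subseteq> S \<Longrightarrow> smooth_on T f"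
  unfolding smooth_on_def using Ck_on_subset by blast

lemma smooth_on_const: "smooth_on S (\<lambda>x. c)"
  by (simp add: smooth_on_def Ck_on_const)

lemma smooth_on_add: "open S \<Longrightarrow> smooth_on S f \<Longrightarrow> smooth_on S g \<Longrightarrow> smooth_on S (\<lambda>x. f x + g x)"
  by (simp add: smooth_on_def Ck_on_add)

lemma smooth_on_mult:
  fixes f g :: "'b::real_normed_vector \<Rightarrow> real"
  shows "open S \<Longrightarrow> smooth_on S f \<Longrightarrow> smooth_on S g \<Longrightarrow> smooth_on S (\<lambda>x. f x * g x)"
  using Ck_on_scaleR[of S _ f g] by (simp add: smooth_on_def)

lemma smooth_on_bounded_linear:
  "open S \<Longrightarrow> bounded_linear L \<Longrightarrow> smooth_on S f \<Longrightarrow> smooth_on S (\<lambda>x. L (f x))"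
  by (simp add: smooth_on_def Ck_on_bounded_linear)

lemma smooth_on_id: "smooth_on S (\<lambda>x. x)"
proof -
  have "Ck_on k S (\<lambda>x. x)" for k
    by (cases k) (auto simp: Ck_on_const frechet_derivative_at[OF has_derivative_ident, symmetric])
  then show ?thesis by (simp add: smooth_on_def)
qed

lemma smooth_on_has_derivative:
  "smooth_on S f \<Longrightarrow> x \<in> S \<Longrightarrow> (f has_derivative frechet_derivative f (at x)) (at x)"
  unfolding smooth_on_def using Ck_on_Suc_has_derivative by blast

lemma smooth_on_frechet_derivative:
  "smooth_on S f \<Longrightarrow> smooth_on S (\<lambda>x. frechet_derivative f (at x) v)"
  unfolding smooth_on_def by (metis Ck_on.simps(2))

lemma smooth_on_imp_continuous_on: "smooth_on S f \<Longrightarrow> continuous_on S f"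
  unfolding smooth_on_def using Ck_on.simps(1) by blast

section \<open>Hadamard's lemma\<close>

lemma segment_in_ball:
  fixes a y :: "'b::real_normed_vector"
  assumes "y \<in> ball a r" "0 \<le> t" "t \<le> 1"
  shows "a + t *\<^sub>R (y - a) \<in> ball a r"
proof -
  have "norm (t *\<^sub>R (y - a)) \<le> norm (y - a)"
    using assms by (simp add: mult_left_le_one_le)
  then show ?thesis
    using assms(1) by (simp add: dist_norm norm_minus_commute)
qed

text \<open>The power of \<open>t\<close> makes the family of integrals closed under differentiation in \<open>y\<close>, since
  every derivative produces one factor \<open>t\<close>.\<close>

lemma ray_integral_has_derivative:
  fixes F :: "'b::euclidean_space \<Rightarrow> real"
  assumes F: "smooth_on (ball a r) F" and y: "y \<in> ball a r"
  shows "((\<lambda>y. integral (cbox 0 1) (\<lambda>t. t ^ j * F (a + t *\<^sub>R (y - a)))) has_derivative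
    (\<lambda>v. integral (cbox 0 1) (\<lambda>t. t ^ Suc j * frechet_derivative F (at (a + t *\<^sub>R (y - a))) v))) (at y)"
proof -
  let ?B = "ball a r"
  let ?D = "\<lambda>x v. frechet_derivative F (at x) v"
  let ?p = "\<lambda>y t. a + t *\<^sub>R (y - a)"
  let ?f = "\<lambda>y t. t ^ j * F (?p y t)"
  define f' where "f' y t = (\<Sum>b\<in>Basis. (t ^ Suc j * ?D (?p y t) b) *\<^sub>R blinfun_inner_left b)" for y t
  have lin: "linear (?D x)" if "x \<in> ?B" for x
    using smooth_on_has_derivative[OF F that] has_derivative_linear by blast
  have f': "blinfun_apply (f' y t) v = t ^ Suc j * ?D (?p y t) v" if "y \<in> ?B" "t \<in> cbox 0 1" for y t v
  proof -
    have p: "?p y t \<in> ?B" using segment_in_ball that by auto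
    have "blinfun_apply (f' y t) v = t ^ Suc j * (\<Sum>b\<in>Basis. (v \<bullet> b) * ?D (?p y t) b)"
      by (simp add: f'_def blinfun.sum_left blinfun.scaleR_left sum_distrib_left mult_ac inner_commute)
    also have "(\<Sum>b\<in>Basis. (v \<bullet> b) * ?D (?p y t) b) = ?D (?p y t) v"
      using linear_Basis_expansion[OF lin[OF p], of v] by simp
    finally show ?thesis .
  qed
  have sub: "(\<lambda>(y, t). ?p y t) ` (?B \<times> cbox 0 1) \<subseteq> ?B"
    using segment_in_ball by auto
  have cont: "continuous_on (?B \<times> cbox 0 1) (\<lambda>(y, t). G (?p y t))" if "smooth_on ?B G" for G :: "'b \<Rightarrow> real"
  proof -
    have "continuous_on (?B \<times> cbox 0 1) (\<lambda>(y, t). ?p y t)"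
      unfolding split_beta by (intro continuous_intros)
    from continuous_on_compose2[OF smooth_on_imp_continuous_on[OF that] this sub]
    show ?thesis by (simp add: split_beta)
  qed
  have D: "((\<lambda>y. ?f y t) has_derivative blinfun_apply (f' y t)) (at y within ?B)"
    if "y \<in> ?B" "t \<in> cbox 0 1" for y t
  proof -
    have p: "?p y t \<in> ?B" using segment_in_ball that by auto
    have "((\<lambda>y. ?p y t) has_derivative (\<lambda>v. t *\<^sub>R v)) (at y)"
      by (auto intro!: derivative_eq_intros)
    from has_derivative_mult_right[OF diff_chain_at[OF this smooth_on_has_derivative[OF F p]], of "t ^ j"]
    have "((\<lambda>y. t ^ j * F (?p y t)) has_derivative (\<lambda>v. t ^ j * ?D (?p y t) (t *\<^sub>R v))) (at y)"
      by (simp only: o_def)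
    moreover have "(\<lambda>v. t ^ j * ?D (?p y t) (t *\<^sub>R v)) = blinfun_apply (f' y t)"
      by (intro ext) (simp add: f'[OF that] linear_cmul[OF lin[OF p]])
    ultimately show ?thesis by (simp add: has_derivative_at_withinI)
  qed
  have "continuous_on (cbox 0 1) (?f y)" if "y \<in> ?B" for y
    using that segment_in_ball
    by (intro continuous_intros continuous_on_compose2[OF smooth_on_imp_continuous_on[OF F]]) auto
  then have I: "?f y integrable_on cbox 0 1" if "y \<in> ?B" for y
    using that integrable_continuous by blast
  have "continuous_on (?B \<times> cbox 0 1) (\<lambda>x. ?D (?p (fst x) (snd x)) b)" for b
    using cont[OF smooth_on_frechet_derivative[OF F], of b] by (simp add: split_beta)
  then have C: "continuous_on (?B \<times> cbox 0 1) (\<lambda>(y, t). f' y t)"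
    unfolding f'_def split_beta
    by (intro continuous_on_sum continuous_on_scaleR continuous_on_mult continuous_on_power
        continuous_on_snd continuous_on_const continuous_on_id)
  have L: "((\<lambda>y. integral (cbox 0 1) (?f y)) has_derivative integral (cbox 0 1) (f' y)) (at y)"
    using leibniz_rule[OF D I C y convex_ball] unfolding at_within_open[OF y open_ball] .
  have "continuous_on (cbox 0 1) (\<lambda>t. f' y t)"
  proof -
    have "continuous_on (cbox 0 1) (\<lambda>t::real. (y, t))" "(\<lambda>t::real. (y, t)) ` cbox 0 1 \<subseteq> ?B \<times> cbox 0 1"
      using y by (auto intro!: continuous_on_Pair)
    from continuous_on_compose2[OF C this] show ?thesis by simp
  qed
  then have "f' y integrable_on cbox 0 1"
    using integrable_continuous by blast
  then have "blinfun_apply (integral (cbox 0 1) (f' y)) v = integral (cbox 0 1) (\<lambda>t. blinfun_apply (f' y t) v)" for v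
    using integral_linear[OF _ blinfun.bounded_linear_left[of v], of "f' y"] by (simp add: o_def)
  moreover have "integral (cbox 0 1) (\<lambda>t. blinfun_apply (f' y t) v)
      = integral (cbox 0 1) (\<lambda>t. t ^ Suc j * ?D (?p y t) v)" for v
    using f'[OF y] by (intro integral_cong) auto
  ultimately have "blinfun_apply (integral (cbox 0 1) (f' y))
      = (\<lambda>v. integral (cbox 0 1) (\<lambda>t. t ^ Suc j * ?D (?p y t) v))"
    by (intro ext) simp
  then show ?thesis using L by simp
qed

lemma ray_integral_smooth:
  fixes F :: "'b::euclidean_space \<Rightarrow> real"
  assumes "smooth_on (ball a r) F"
  shows "smooth_on (ball a r) (\<lambda>y. integral (cbox 0 1) (\<lambda>t. t ^ j * F (a + t *\<^sub>R (y - a))))"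
proof -
  have "Ck_on k (ball a r) (\<lambda>y. integral (cbox 0 1) (\<lambda>t. t ^ j * F (a + t *\<^sub>R (y - a))))" for k
    using assms
  proof (induction k arbitrary: j F)
    case 0
    have "isCont (\<lambda>y. integral (cbox 0 1) (\<lambda>t. t ^ j * F (a + t *\<^sub>R (y - a)))) x" if "x \<in> ball a r" for x
      using has_derivative_continuous[OF ray_integral_has_derivative[OF 0 that]] .
    then show ?case
      unfolding Ck_on.simps by (intro continuous_at_imp_continuous_on ballI)
  next
    case (Suc k)
    show ?case
      by (intro Ck_on_Suc[OF open_ball ray_integral_has_derivative] Suc.IH smooth_on_frechet_derivative)
         (use Suc.prems in auto)
  qed
  then show ?thesis by (simp add: smooth_on_def)
qed

text \<open>The coefficients are the averages of the partial derivatives of \<open>F\<close> over the segments from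
  \<open>a\<close>, so that the expansion is the fundamental theorem of calculus on these segments.\<close>

lemma Hadamard:
  fixes F :: "'b::euclidean_space \<Rightarrow> real"
  assumes F: "smooth_on (ball a r) F"
  obtains G where "\<And>b. smooth_on (ball a r) (G b)"
    and "\<And>b. G b a = frechet_derivative F (at a) b"
    and "\<And>y. y \<in> ball a r \<Longrightarrow> F y = F a + (\<Sum>b\<in>Basis. ((y - a) \<bullet> b) * G b y)"
proof -
  let ?D = "\<lambda>x v. frechet_derivative F (at x) v"
  define G where "G b y = integral (cbox 0 1) (\<lambda>t. ?D (a + t *\<^sub>R (y - a)) b)" for b y
  have 1: "smooth_on (ball a r) (G b)" for b
    using ray_integral_smooth[OF smooth_on_frechet_derivative[OF F], of 0 b]
    by (simp add: G_def[abs_def])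
  have 2: "G b a = ?D a b" for b
    by (simp add: G_def)
  have 3: "F y = F a + (\<Sum>b\<in>Basis. ((y - a) \<bullet> b) * G b y)" if y: "y \<in> ball a r" for y
  proof -
    let ?p = "\<lambda>t. a + t *\<^sub>R (y - a)"
    have p: "?p t \<in> ball a r" if "t \<in> {0..1}" for t
      using segment_in_ball[OF y] that by auto
    have lin: "linear (?D (?p t))" if "t \<in> {0..1}" for t
      using smooth_on_has_derivative[OF F p[OF that]] has_derivative_linear by blast
    have "((\<lambda>t. F (?p t)) has_vector_derivative ?D (?p t) (y - a)) (at t within {0..1})"
      if "t \<in> {0..1}" for t
    proof -
      have "(?p has_derivative (\<lambda>s. s *\<^sub>R (y - a))) (at t)"
        by (auto intro!: derivative_eq_intros)
      from diff_chain_at[OF this smooth_on_has_derivative[OF F p[OF that]]]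
      show ?thesis
        using linear_cmul[OF lin[OF that]]
        by (simp add: has_vector_derivative_def o_def has_derivative_at_withinI)
    qed
    then have "((\<lambda>t. ?D (?p t) (y - a)) has_integral F (?p 1) - F (?p 0)) {0..1}"
      by (intro fundamental_theorem_of_calculus) auto
    then have I: "integral {0..1} (\<lambda>t. ?D (?p t) (y - a)) = F y - F a"
      by (simp add: integral_unique)
    have "?D (?p t) (y - a) = (\<Sum>b\<in>Basis. ((y - a) \<bullet> b) * ?D (?p t) b)" if "t \<in> {0..1}" for t
      using linear_Basis_expansion[OF lin[OF that], of "y - a"] by simp
    then have "integral {0..1} (\<lambda>t. ?D (?p t) (y - a))
        = integral {0..1} (\<lambda>t. \<Sum>b\<in>Basis. ((y - a) \<bullet> b) * ?D (?p t) b)"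
      by (intro integral_cong) auto
    also have "\<dots> = (\<Sum>b\<in>Basis. integral {0..1} (\<lambda>t. ((y - a) \<bullet> b) * ?D (?p t) b))"
    proof (rule integral_sum)
      fix b :: 'b
      have "continuous_on {0..1} ?p" "?p ` {0..1} \<subseteq> ball a r"
        using p by (auto intro!: continuous_intros simp del: mem_ball)
      from continuous_on_compose2[OF smooth_on_imp_continuous_on[OF smooth_on_frechet_derivative[OF F]] this]
      show "(\<lambda>t. ((y - a) \<bullet> b) * ?D (?p t) b) integrable_on {0..1}"
        by (intro integrable_continuous_real continuous_on_mult continuous_on_const)
    qed simp
    also have "\<dots> = (\<Sum>b\<in>Basis. ((y - a) \<bullet> b) * G b y)"
      by (simp add: G_def)
    finally show ?thesis using I by simp
  qed
  show ?thesis using that[of G] 1 2 3 by blast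
qed

section \<open>Exterior products and degenerate directions\<close>

definition multilinear :: "nat \<Rightarrow> ((nat \<Rightarrow> 'b::real_vector) \<Rightarrow> real) \<Rightarrow> bool" where
  "multilinear m F \<longleftrightarrow> (\<forall>j<m. \<forall>v. linear (\<lambda>x. F (v(j := x))))"

text \<open>Exchanging two equal arguments pairs off the permutations with opposite signs.\<close>

lemma wedge_eq_0_if_repeated:
  assumes "i < k + l" "j < k + l" "i \<noteq> j" "v i = v j"
  shows "wedge k l \<alpha> \<beta> v = 0"
proof -
  let ?P = "{\<sigma>. \<sigma> permutes {..<k + l}}"
  let ?\<tau> = "Transposition.transpose i j"
  let ?g = "\<lambda>\<sigma>. of_int (sign \<sigma>) * \<alpha> (\<lambda>i. v (\<sigma> i)) * \<beta> (\<lambda>i. v (\<sigma> (k + i)))"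
  have \<tau>: "?\<tau> permutes {..<k + l}"
    using assms by (simp add: permutes_swap_id)
  have v: "v (?\<tau> x) = v x" for x
    using assms(4) by (simp add: Transposition.transpose_def)
  have g: "?g (?\<tau> \<circ> \<sigma>) = - ?g \<sigma>" if "\<sigma> permutes {..<k + l}" for \<sigma>
  proof -
    have "sign (?\<tau> \<circ> \<sigma>) = - sign \<sigma>"
      using sign_compose[of ?\<tau> \<sigma>] permutes_imp_permutation[OF _ \<tau>] permutes_imp_permutation[OF _ that]
        assms(3) by (simp add: sign_swap_id)
    then show ?thesis by (simp add: v)
  qed
  have "sum ?g ?P = sum (\<lambda>\<sigma>. ?g (?\<tau> \<circ> \<sigma>)) ?P"
    using \<tau> by (intro sum.reindex_bij_witness[of _ "\<lambda>\<sigma>. ?\<tau> \<circ> \<sigma>" "\<lambda>\<sigma>. ?\<tau> \<circ> \<sigma>"])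
      (auto simp: permutes_compose o_assoc)
  also have "\<dots> = - sum ?g ?P"
    using g by (simp add: sum_negf[symmetric])
  finally have "sum ?g ?P = 0" by simp
  then show ?thesis by (simp add: wedge_def)
qed

lemma multilinear_wedge:
  assumes \<alpha>: "multilinear k \<alpha>" and \<beta>: "multilinear l \<beta>"
    and \<alpha>_cong: "\<And>v w. (\<And>i. i < k \<Longrightarrow> v i = w i) \<Longrightarrow> \<alpha> v = \<alpha> w"
  shows "multilinear (k + l) (wedge k l \<alpha> \<beta>)"
  unfolding multilinear_def
proof (intro allI impI)
  fix j v assume j: "j < k + l"
  let ?g = "\<lambda>\<sigma> v. of_int (sign \<sigma>) * \<alpha> (\<lambda>i. v (\<sigma> i)) * \<beta> (\<lambda>i. v (\<sigma> (k + i)))"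
  have "linear (\<lambda>x. ?g \<sigma> (v(j := x)))" if \<sigma>: "\<sigma> permutes {..<k + l}" for \<sigma>
  proof -
    define m where "m = inv \<sigma> j"
    have m: "\<sigma> i = j \<longleftrightarrow> i = m" for i
      using \<sigma> m_def permutes_inv_eq by metis
    have "\<sigma> m = j" using m by blast
    then have "m < k + l"
      using j permutes_in_image[OF \<sigma>, of m] by simp
    consider "m < k" | m' where "m = k + m'" "m' < l"
      using \<open>m < k + l\<close> by (metis add_less_cancel_left le_Suc_ex not_less)
    then show ?thesis
    proof cases
      case 1
      have "(\<lambda>i. (v(j := x)) (\<sigma> i)) = (\<lambda>i. v (\<sigma> i))(m := x)"
        "(\<lambda>i. (v(j := x)) (\<sigma> (k + i))) = (\<lambda>i. v (\<sigma> (k + i)))" for x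
        using m 1 by (auto simp: fun_eq_iff)
      moreover have "linear (\<lambda>x. \<alpha> ((\<lambda>i. v (\<sigma> i))(m := x)))"
        using \<alpha> 1 by (simp add: multilinear_def)
      ultimately show ?thesis
        by (simp add: linear_iff algebra_simps)
    next
      case (2 m')
      have "(\<lambda>i. (v(j := x)) (\<sigma> (k + i))) = (\<lambda>i. v (\<sigma> (k + i)))(m' := x)" for x
        using m 2 by (auto simp: fun_eq_iff)
      moreover have "\<alpha> (\<lambda>i. (v(j := x)) (\<sigma> i)) = \<alpha> (\<lambda>i. v (\<sigma> i))" for x
        using m 2 by (intro \<alpha>_cong) auto
      moreover have "linear (\<lambda>x. \<beta> ((\<lambda>i. v (\<sigma> (k + i)))(m' := x)))"
        using \<beta> 2 by (simp add: multilinear_def)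
      ultimately show ?thesis
        by (simp add: linear_iff algebra_simps)
    qed
  qed
  then have "linear (\<lambda>x. \<Sum>\<sigma> | \<sigma> permutes {..<k + l}. ?g \<sigma> (v(j := x)))"
    by (intro linear_compose_sum) auto
  then show "linear (\<lambda>x. wedge k l \<alpha> \<beta> (v(j := x)))"
    by (simp add: wedge_def linear_iff add_divide_distrib)
qed

lemma wedge_cong:
  assumes "\<And>v w. (\<And>i. i < k \<Longrightarrow> v i = w i) \<Longrightarrow> \<alpha> v = \<alpha> w"
    and "\<And>v w. (\<And>i. i < l \<Longrightarrow> v i = w i) \<Longrightarrow> \<beta> v = \<beta> w"
    and eq: "\<And>i. i < k + l \<Longrightarrow> v i = w i"
  shows "wedge k l \<alpha> \<beta> v = wedge k l \<alpha> \<beta> w"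
proof -
  have "\<alpha> (\<lambda>i. v (\<sigma> i)) = \<alpha> (\<lambda>i. w (\<sigma> i)) \<and> \<beta> (\<lambda>i. v (\<sigma> (k + i))) = \<beta> (\<lambda>i. w (\<sigma> (k + i)))"
    if "\<sigma> permutes {..<k + l}" for \<sigma>
  proof -
    have "v (\<sigma> i) = w (\<sigma> i)" if "i < k + l" for i
      using permutes_in_image[OF \<open>\<sigma> permutes {..<k + l}\<close>, of i] that eq by simp
    then show ?thesis
      by (intro conjI assms(1,2)) simp_all
  qed
  then show ?thesis by (simp add: wedge_def)
qed

lemma wedge_power_cong:
  "(\<And>i. i < 2 * n \<Longrightarrow> v i = w i) \<Longrightarrow> wedge_power \<Omega> n v = wedge_power \<Omega> n w"
proof (induction n arbitrary: v w)
  case (Suc n)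
  show ?case
    unfolding wedge_power.simps
  proof (rule wedge_cong)
    show "v i = w i" if "i < 2 + 2 * n" for i
      using that by (intro Suc.prems) simp
  qed (simp, erule Suc.IH)
qed simp

lemma multilinear_wedge_power:
  assumes "\<And>x. linear (\<Omega> x)" "\<And>y. linear (\<lambda>x. \<Omega> x y)"
  shows "multilinear (2 * n) (wedge_power \<Omega> n)"
proof (induction n)
  case 0
  then show ?case by (simp add: multilinear_def)
next
  case (Suc n)
  have "multilinear 2 (\<lambda>v. \<Omega> (v 0) (v 1))"
    using assms by (auto simp: multilinear_def less_2_cases_iff)
  from multilinear_wedge[OF this Suc] show ?case by simp
qed

lemma multilinear_eq_0_if_dependent:
  fixes v :: "nat \<Rightarrow> 'b::euclidean_space"
  assumes F: "multilinear m F"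
    and alt: "\<And>v i j. i < m \<Longrightarrow> j < m \<Longrightarrow> i \<noteq> j \<Longrightarrow> v i = v j \<Longrightarrow> F v = 0"
    and "dim (v ` {..<m}) < m"
  shows "F v = 0"
proof (cases "inj_on v {..<m}")
  case False
  then show ?thesis using alt by (auto simp: inj_on_def)
next
  case inj: True
  then have "dependent (v ` {..<m})"
    using assms(3) by (metis card_image card_lessThan dim_eq_card_independent less_irrefl)
  then obtain u k where k: "k < m" "u (v k) \<noteq> 0" and "(\<Sum>x\<in>v ` {..<m}. u x *\<^sub>R x) = 0"
    by (auto simp: dependent_finite)
  then have 0: "(\<Sum>i<m. u (v i) *\<^sub>R v i) = 0"
    using inj by (simp add: sum.reindex)
  \<comment> \<open>Replacing the \<open>k\<close>-th argument by this vanishing combination leaves only its \<open>k\<close>-th term,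
    as every other term repeats an argument.\<close>
  have lin: "linear (\<lambda>x. F (v(k := x)))"
    using F k by (simp add: multilinear_def)
  have "F (v(k := v i)) = 0" if "i < m" "i \<noteq> k" for i
    using that k by (intro alt[of i k]) auto
  then have "(\<Sum>i<m. u (v i) * F (v(k := v i))) = (\<Sum>i\<in>{k}. u (v i) * F (v(k := v i)))"
    using k by (intro sum.mono_neutral_right) auto
  moreover have "(\<Sum>i<m. u (v i) * F (v(k := v i))) = F (v(k := \<Sum>i<m. u (v i) *\<^sub>R v i))"
    using linear_sum[OF lin, of "\<lambda>i. u (v i) *\<^sub>R v i" "{..<m}"] linear_cmul[OF lin] by simp
  ultimately have "u (v k) * F v = 0"
    using 0 linear_0[OF lin] by simp
  then show ?thesis using k by simp
qed

lemma wedge_power_pullback: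
  "wedge_power \<Omega> n (\<lambda>i. A (w i)) = wedge_power (\<lambda>x y. \<Omega> (A x) (A y)) n w"
  by (induction n arbitrary: w) (simp_all add: wedge_def)

text \<open>A common degenerate direction \<open>x\<close> allows one to replace all arguments by their orthogonal
  projections along \<open>x\<close>. The hyperplane orthogonal to \<open>x\<close> has dimension \<open>2 n\<close>, so that \<open>2 n + 1\<close>
  vectors in it are dependent.\<close>

lemma wedge_eq_0_if_degenerate:
  fixes \<omega> :: "'b::euclidean_space \<Rightarrow> real"
  assumes dim: "DIM('b) = 2 * n + 1" and \<omega>: "linear \<omega>"
    and \<Omega>: "\<And>x. linear (\<Omega> x)" "\<And>y. linear (\<lambda>x. \<Omega> x y)"
    and x: "x \<noteq> 0" "\<omega> x = 0" "\<And>y. \<Omega> x y = 0" "\<And>y. \<Omega> y x = 0"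
  shows "wedge 1 (2 * n) (\<lambda>v. \<omega> (v 0)) (wedge_power \<Omega> n) w = 0"
proof -
  define P where "P y = y - ((x \<bullet> y) / (x \<bullet> x)) *\<^sub>R x" for y
  let ?\<Phi> = "wedge 1 (2 * n) (\<lambda>v. \<omega> (v 0)) (wedge_power \<Omega> n)"
  have "\<omega> (P y) = \<omega> y" for y
    by (simp add: P_def linear_diff[OF \<omega>] linear_cmul[OF \<omega>] x)
  moreover have "\<Omega> (P y) (P z) = \<Omega> y z" for y z
  proof -
    have "\<Omega> (P y) (P z) = \<Omega> (P y) z"
      by (simp add: P_def[of z] linear_diff[OF \<Omega>(1)] linear_cmul[OF \<Omega>(1)] x)
    then show ?thesis
      by (simp add: P_def linear_diff[OF \<Omega>(2)] linear_cmul[OF \<Omega>(2)] x)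
  qed
  moreover from this have "wedge_power \<Omega> n (\<lambda>i. P (u i)) = wedge_power \<Omega> n u" for u
    using wedge_power_pullback[of \<Omega> n P u] by simp
  ultimately have "?\<Phi> (\<lambda>i. P (w i)) = ?\<Phi> w"
    by (simp add: wedge_def)
  moreover have "?\<Phi> (\<lambda>i. P (w i)) = 0"
  proof (rule multilinear_eq_0_if_dependent[where m = "1 + 2 * n" and F = ?\<Phi>])
    have "multilinear 1 (\<lambda>v. \<omega> (v 0))"
      using \<omega> by (simp add: multilinear_def)
    then show "multilinear (1 + 2 * n) ?\<Phi>"
      by (intro multilinear_wedge multilinear_wedge_power \<Omega>) auto
    show "?\<Phi> v = 0" if "i < 1 + 2 * n" "j < 1 + 2 * n" "i \<noteq> j" "v i = v j" for v i j
      using wedge_eq_0_if_repeated that by blast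
    have "(\<lambda>i. P (w i)) ` {..<1 + 2 * n} \<subseteq> {y. x \<bullet> y = 0}"
      using x(1) by (auto simp: P_def inner_diff_right)
    then have "dim ((\<lambda>i. P (w i)) ` {..<1 + 2 * n}) \<le> dim {y. x \<bullet> y = 0}"
      by (rule dim_subset)
    also have "\<dots> < 1 + 2 * n"
      using dim_hyperplane[OF x(1)] dim by simp
    finally show "dim ((\<lambda>i. P (w i)) ` {..<1 + 2 * n}) < 1 + 2 * n" .
  qed
  ultimately show ?thesis by simp
qed

section \<open>Smooth functions and tangent vectors on a manifold\<close>

text \<open>The vector with coefficients \<open>w\<close> with respect to the coordinate basis of the chart \<open>(V, \<phi>)\<close>.\<close>

definition coord_vec :: "('a, 'b::euclidean_space) charted_space \<Rightarrow> 'a set \<Rightarrow> ('a \<Rightarrow> 'b) \<Rightarrow> 'b \<Rightarrow> 'a \<Rightarrow> 'a tvec" where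
  "coord_vec M V \<phi> w p = (\<lambda>f. if smooth_near M p f
     then frechet_derivative (f \<circ> inv_into V \<phi>) (at (\<phi> p)) w else 0)"

locale smooth_mfd =
  fixes M :: "('a, 'b::euclidean_space) charted_space"
  assumes smooth_manifold: "smooth_manifold M"
begin

lemma chart_axioms:
  assumes "(V, \<phi>) \<in> charts M"
  shows chart_openin: "openin (mtop M) V"
    and open_chart_image: "open (\<phi> ` V)"
    and chart_homeomorphic: "homeomorphic_map (subtopology (mtop M) V) (top_of_set (\<phi> ` V)) \<phi>"
proof -
  have "\<forall>(U, \<phi>)\<in>charts M. openin (mtop M) U \<and> open (\<phi> ` U) \<and>
      homeomorphic_map (subtopology (mtop M) U) (top_of_set (\<phi> ` U)) \<phi>"
    using smooth_manifold unfolding smooth_manifold_def by (elim conjE) assumption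
  from bspec[OF this assms] show "openin (mtop M) V" "open (\<phi> ` V)"
    "homeomorphic_map (subtopology (mtop M) V) (top_of_set (\<phi> ` V)) \<phi>" by simp_all
qed

lemma chart_transition_smooth:
  assumes "(V, \<phi>) \<in> charts M" "(V', \<phi>') \<in> charts M"
  shows "smooth_on (\<phi> ` (V \<inter> V')) (\<phi>' \<circ> inv_into V \<phi>)"
proof -
  have "\<forall>(V, \<phi>)\<in>charts M. \<forall>(V', \<phi>')\<in>charts M. smooth_on (\<phi> ` (V \<inter> V')) (\<phi>' \<circ> inv_into V \<phi>)"
    using smooth_manifold unfolding smooth_manifold_def by (elim conjE) assumption
  then show ?thesis using assms by fastforce
qed

lemma chart_topspace: "(V, \<phi>) \<in> charts M \<Longrightarrow> topspace (subtopology (mtop M) V) = V"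
  using openin_subset[OF chart_openin] by (auto simp: topspace_subtopology)

lemma chart_inj_on: "(V, \<phi>) \<in> charts M \<Longrightarrow> inj_on \<phi> V"
  using homeomorphic_imp_injective_map[OF chart_homeomorphic] by (simp only: chart_topspace)

lemma chart_open_image:
  assumes "(V, \<phi>) \<in> charts M" "openin (mtop M) W"
  shows "open (\<phi> ` (W \<inter> V))"
proof -
  have "openin (subtopology (mtop M) V) (W \<inter> V)"
    using assms(2) by (auto simp: openin_subtopology)
  then have "openin (top_of_set (\<phi> ` V)) (\<phi> ` (W \<inter> V))"
    using homeomorphic_imp_open_map[OF chart_homeomorphic[OF assms(1)]] by (simp add: open_map_def)
  then show ?thesis using openin_open_trans open_chart_image[OF assms(1)] by blast
qed

lemma chart_openin_preimage:
  assumes "(V, \<phi>) \<in> charts M" "open B"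
  shows "openin (mtop M) {x \<in> V. \<phi> x \<in> B}"
proof -
  have B: "openin (top_of_set (\<phi> ` V)) (\<phi> ` V \<inter> B)"
    using assms(2) by (simp add: openin_open_Int)
  have "openin (subtopology (mtop M) V) {x \<in> V. \<phi> x \<in> \<phi> ` V \<inter> B}"
    using openin_continuous_map_preimage[OF
        homeomorphic_imp_continuous_map[OF chart_homeomorphic[OF assms(1)]] B]
    unfolding chart_topspace[OF assms(1)] .
  moreover have "{x \<in> V. \<phi> x \<in> \<phi> ` V \<inter> B} = {x \<in> V. \<phi> x \<in> B}" by blast
  ultimately show ?thesis
    using openin_trans_full[OF _ chart_openin[OF assms(1)]] by simp
qed

lemma chart_at:
  assumes "p \<in> topspace (mtop M)"
  obtains V \<phi> where "(V, \<phi>) \<in> charts M" "p \<in> V"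
proof -
  have "(\<Union>(U, \<phi>)\<in>charts M. U) = topspace (mtop M)"
    using smooth_manifold unfolding smooth_manifold_def by (elim conjE) assumption
  then show ?thesis using assms that by auto
qed

lemma smooth_fun_in_chart:
  "smooth_fun M W f \<Longrightarrow> (V, \<phi>) \<in> charts M \<Longrightarrow> smooth_on (\<phi> ` (W \<inter> V)) (f \<circ> inv_into V \<phi>)"
  unfolding smooth_fun_def by blast

lemma smooth_funI:
  assumes "openin (mtop M) W"
    and "\<And>V \<phi>. (V, \<phi>) \<in> charts M \<Longrightarrow> open (\<phi> ` (W \<inter> V)) \<Longrightarrow> smooth_on (\<phi> ` (W \<inter> V)) (f \<circ> inv_into V \<phi>)"
  shows "smooth_fun M W f"
  unfolding smooth_fun_def using assms(1)
  by (auto intro!: assms(2) chart_open_image)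

lemma smooth_fun_openin: "smooth_fun M W f \<Longrightarrow> openin (mtop M) W"
  unfolding smooth_fun_def by blast

lemma smooth_fun_subset:
  assumes "smooth_fun M W f" "openin (mtop M) W'" "W' \<subseteq> W"
  shows "smooth_fun M W' f"
  using assms(2)
proof (rule smooth_funI)
  fix V \<phi> assume V: "(V, \<phi>) \<in> charts M"
  have "\<phi> ` (W' \<inter> V) \<subseteq> \<phi> ` (W \<inter> V)" using assms(3) by blast
  then show "smooth_on (\<phi> ` (W' \<inter> V)) (f \<circ> inv_into V \<phi>)"
    by (rule smooth_on_subset[OF smooth_fun_in_chart[OF assms(1) V]])
qed

lemma smooth_fun_cong:
  assumes f: "smooth_fun M W f" and eq: "\<And>x. x \<in> W \<Longrightarrow> f x = g x"
  shows "smooth_fun M W g"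
  using smooth_fun_openin[OF f]
proof (rule smooth_funI)
  fix V \<phi> assume V: "(V, \<phi>) \<in> charts M" and "open (\<phi> ` (W \<inter> V))"
  then show "smooth_on (\<phi> ` (W \<inter> V)) (g \<circ> inv_into V \<phi>)"
    using smooth_fun_in_chart[OF f V] chart_inj_on[OF V]
    by (rule_tac smooth_on_cong[of _ "f \<circ> inv_into V \<phi>"]) (auto simp: eq)
qed

lemma smooth_fun_const: "openin (mtop M) W \<Longrightarrow> smooth_fun M W (\<lambda>x. c)"
  by (rule smooth_funI) (auto simp: o_def smooth_on_const)

lemma smooth_fun_add:
  assumes f: "smooth_fun M W f" and g: "smooth_fun M W g"
  shows "smooth_fun M W (\<lambda>x. f x + g x)"
  using smooth_fun_openin[OF f]
proof (rule smooth_funI)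
  fix V \<phi> assume V: "(V, \<phi>) \<in> charts M" and o: "open (\<phi> ` (W \<inter> V))"
  show "smooth_on (\<phi> ` (W \<inter> V)) ((\<lambda>x. f x + g x) \<circ> inv_into V \<phi>)"
    using smooth_on_add[OF o smooth_fun_in_chart[OF f V] smooth_fun_in_chart[OF g V]]
    by (simp add: o_def)
qed

lemma smooth_fun_mult:
  assumes f: "smooth_fun M W f" and g: "smooth_fun M W g"
  shows "smooth_fun M W (\<lambda>x. f x * g x)"
  using smooth_fun_openin[OF f]
proof (rule smooth_funI)
  fix V \<phi> assume V: "(V, \<phi>) \<in> charts M" and o: "open (\<phi> ` (W \<inter> V))"
  show "smooth_on (\<phi> ` (W \<inter> V)) ((\<lambda>x. f x * g x) \<circ> inv_into V \<phi>)"
    using smooth_on_mult[OF o smooth_fun_in_chart[OF f V] smooth_fun_in_chart[OF g V]]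
    by (simp add: o_def)
qed

lemma smooth_fun_lincomb:
  assumes "smooth_fun M W f" "smooth_fun M W g"
  shows "smooth_fun M W (\<lambda>x. a * f x + b * g x)"
  by (intro smooth_fun_add smooth_fun_mult smooth_fun_const assms smooth_fun_openin[OF assms(1)])

lemma smooth_fun_diff:
  assumes "smooth_fun M W f" "smooth_fun M W g"
  shows "smooth_fun M W (\<lambda>x. f x - g x)"
  using smooth_fun_lincomb[OF assms, of 1 "-1"] by simp

lemma smooth_fun_chart_comp:
  assumes V: "(V, \<phi>) \<in> charts M" and W: "openin (mtop M) W" "W \<subseteq> V" and G: "smooth_on (\<phi> ` W) G"
  shows "smooth_fun M W (G \<circ> \<phi>)"
  using W(1)
proof (rule smooth_funI)
  fix V' \<phi>' assume V': "(V', \<phi>') \<in> charts M" and o: "open (\<phi>' ` (W \<inter> V'))"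
  have "smooth_on (\<phi>' ` (V' \<inter> V)) (\<phi> \<circ> inv_into V' \<phi>')"
    using chart_transition_smooth[OF V' V] .
  then have "smooth_on (\<phi>' ` (W \<inter> V')) (\<phi> \<circ> inv_into V' \<phi>')"
    using W(2) by (rule_tac smooth_on_subset) auto
  moreover have "open (\<phi> ` W)"
    using chart_open_image[OF V W(1)] W(2) by (simp add: Int_absorb2)
  moreover have "(\<phi> \<circ> inv_into V' \<phi>') ` (\<phi>' ` (W \<inter> V')) \<subseteq> \<phi> ` W"
    using chart_inj_on[OF V'] by auto
  ultimately have "smooth_on (\<phi>' ` (W \<inter> V')) (G \<circ> (\<phi> \<circ> inv_into V' \<phi>'))"
    using smooth_on_compose o G by blast
  then show "smooth_on (\<phi>' ` (W \<inter> V')) (G \<circ> \<phi> \<circ> inv_into V' \<phi>')"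
    by (simp add: o_assoc)
qed

lemma smooth_nearI: "smooth_fun M W f \<Longrightarrow> p \<in> W \<Longrightarrow> smooth_near M p f"
  unfolding smooth_near_def by blast

lemma smooth_near_common:
  assumes "smooth_near M p f" "smooth_near M p g"
  obtains W where "p \<in> W" "smooth_fun M W f" "smooth_fun M W g"
proof -
  obtain A B where A: "p \<in> A" "smooth_fun M A f" and B: "p \<in> B" "smooth_fun M B g"
    using assms unfolding smooth_near_def by blast
  then have "openin (mtop M) (A \<inter> B)"
    using smooth_fun_openin by blast
  then show ?thesis
    using that[of "A \<inter> B"] A B smooth_fun_subset by (metis IntI inf_le1 inf_le2)
qed

lemma smooth_near_restrict:
  assumes "smooth_near M p f" "openin (mtop M) U" "p \<in> U"
  obtains W where "p \<in> W" "W \<subseteq> U" "smooth_fun M W f"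
proof -
  obtain A where A: "p \<in> A" "smooth_fun M A f"
    using assms unfolding smooth_near_def by blast
  then have "smooth_fun M (A \<inter> U) f"
    using assms smooth_fun_openin by (intro smooth_fun_subset[OF A(2)]) auto
  then show ?thesis
    using that[of "A \<inter> U"] A assms(3) by blast
qed

lemma smooth_near_cong:
  assumes "smooth_near M p f" "openin (mtop M) U" "p \<in> U" "\<And>x. x \<in> U \<Longrightarrow> f x = g x"
  shows "smooth_near M p g"
proof -
  obtain W where W: "p \<in> W" "W \<subseteq> U" "smooth_fun M W f"
    using smooth_near_restrict[OF assms(1-3)] .
  then have "smooth_fun M W g"
    using assms(4) by (intro smooth_fun_cong[OF W(3)]) auto
  then show ?thesis using W(1) smooth_nearI by blast
qed

lemma smooth_near_const: "p \<in> topspace (mtop M) \<Longrightarrow> smooth_near M p (\<lambda>x. c)"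
  using smooth_nearI[OF smooth_fun_const[OF openin_topspace]] .

lemma smooth_near_lincomb:
  assumes "smooth_near M p f" "smooth_near M p g"
  shows "smooth_near M p (\<lambda>x. a * f x + b * g x)"
proof -
  obtain W where W: "p \<in> W" "smooth_fun M W f" "smooth_fun M W g"
    using smooth_near_common[OF assms] .
  then show ?thesis
    using smooth_nearI[OF smooth_fun_lincomb[OF W(2,3)] W(1)] by simp
qed

lemma smooth_near_add:
  "smooth_near M p f \<Longrightarrow> smooth_near M p g \<Longrightarrow> smooth_near M p (\<lambda>x. f x + g x)"
  by (drule (1) smooth_near_lincomb[where a = 1 and b = 1]) simp

lemma smooth_near_diff:
  "smooth_near M p f \<Longrightarrow> smooth_near M p g \<Longrightarrow> smooth_near M p (\<lambda>x. f x - g x)"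
  by (drule (1) smooth_near_lincomb[where a = 1 and b = "-1"]) simp

lemma smooth_near_mult:
  assumes "smooth_near M p f" "smooth_near M p g"
  shows "smooth_near M p (\<lambda>x. f x * g x)"
proof -
  obtain W where W: "p \<in> W" "smooth_fun M W f" "smooth_fun M W g"
    using smooth_near_common[OF assms] .
  then show ?thesis
    using smooth_nearI[OF smooth_fun_mult[OF W(2,3)] W(1)] by simp
qed

subsection \<open>Calculus with a single tangent vector\<close>

lemma tangent_lincomb:
  "v \<in> tangent M p \<Longrightarrow> smooth_near M p f \<Longrightarrow> smooth_near M p g \<Longrightarrow>
    v (\<lambda>x. a * f x + b * g x) = a * v f + b * v g"
  by (simp add: tangent_def)

lemma tangent_mult:
  "v \<in> tangent M p \<Longrightarrow> smooth_near M p f \<Longrightarrow> smooth_near M p g \<Longrightarrow>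
    v (\<lambda>x. f x * g x) = f p * v g + g p * v f"
  by (simp add: tangent_def)

lemma tangent_not_smooth: "v \<in> tangent M p \<Longrightarrow> \<not> smooth_near M p f \<Longrightarrow> v f = 0"
  by (simp add: tangent_def)

lemma tangent_cong:
  assumes "v \<in> tangent M p" "smooth_near M p f" "openin (mtop M) U" "p \<in> U" "\<And>x. x \<in> U \<Longrightarrow> f x = g x"
  shows "v f = v g"
proof -
  have "\<forall>f g U. smooth_near M p f \<longrightarrow> smooth_near M p g \<longrightarrow> openin (mtop M) U \<longrightarrow> p \<in> U \<longrightarrow>
      (\<forall>x\<in>U. f x = g x) \<longrightarrow> v f = v g"
    using assms(1) unfolding tangent_def mem_Collect_eq by (elim conjE) assumption
  moreover have "smooth_near M p g" by (rule smooth_near_cong[OF assms(2-5)])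
  ultimately show ?thesis using assms by metis
qed

lemma tangent_add:
  "v \<in> tangent M p \<Longrightarrow> smooth_near M p f \<Longrightarrow> smooth_near M p g \<Longrightarrow> v (\<lambda>x. f x + g x) = v f + v g"
  by (drule (2) tangent_lincomb[where a = 1 and b = 1]) simp

lemma tangent_diff:
  "v \<in> tangent M p \<Longrightarrow> smooth_near M p f \<Longrightarrow> smooth_near M p g \<Longrightarrow> v (\<lambda>x. f x - g x) = v f - v g"
  by (drule (2) tangent_lincomb[where a = 1 and b = "-1"]) simp

lemma tangent_const:
  assumes "v \<in> tangent M p" "p \<in> topspace (mtop M)"
  shows "v (\<lambda>x. c) = 0"
proof -
  note s = smooth_near_const[OF assms(2)]
  have "v (\<lambda>x. 1) = 0"
    using tangent_mult[OF assms(1) s s, of 1 1] by simp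
  then show ?thesis
    using tangent_lincomb[OF assms(1) s s, of c 1 0 1] by simp
qed

lemma tangent_sum:
  assumes "v \<in> tangent M p" "p \<in> topspace (mtop M)" "finite I" "\<And>i. i \<in> I \<Longrightarrow> smooth_near M p (g i)"
  shows "smooth_near M p (\<lambda>x. \<Sum>i\<in>I. g i x) \<and> v (\<lambda>x. \<Sum>i\<in>I. g i x) = (\<Sum>i\<in>I. v (g i))"
  using assms(3,4)
proof (induction I rule: finite_induct)
  case empty
  then show ?case using smooth_near_const tangent_const assms by simp
next
  case (insert i I)
  then show ?case using smooth_near_add tangent_add[OF assms(1)] by simp
qed

lemma tangent_combine:
  assumes u: "u \<in> tangent M p" and v: "v \<in> tangent M p"
  shows "(\<lambda>f. a * u f + b * v f) \<in> tangent M p"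
  unfolding tangent_def mem_Collect_eq
proof (intro conjI allI impI)
  fix f g :: "'a \<Rightarrow> real" and c d :: real
  assume fg: "smooth_near M p f" "smooth_near M p g"
  show "a * u (\<lambda>x. c * f x + d * g x) + b * v (\<lambda>x. c * f x + d * g x)
      = c * (a * u f + b * v f) + d * (a * u g + b * v g)"
    using tangent_lincomb[OF u fg] tangent_lincomb[OF v fg] by (simp add: algebra_simps)
  show "a * u (\<lambda>x. f x * g x) + b * v (\<lambda>x. f x * g x)
      = f p * (a * u g + b * v g) + g p * (a * u f + b * v f)"
    using tangent_mult[OF u fg] tangent_mult[OF v fg] by (simp add: algebra_simps)
next
  fix f g :: "'a \<Rightarrow> real" and U
  assume "smooth_near M p f" "openin (mtop M) U" "p \<in> U" "\<forall>x\<in>U. f x = g x"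
  then have "u f = u g" "v f = v g"
    using tangent_cong[OF u] tangent_cong[OF v] by blast+
  then show "a * u f + b * v f = a * u g + b * v g" by simp
next
  fix f assume "\<not> smooth_near M p f"
  then show "a * u f + b * v f = 0"
    using tangent_not_smooth[OF u] tangent_not_smooth[OF v] by simp
qed

subsection \<open>Coordinate vectors\<close>

lemma chart_has_derivative:
  assumes "(V, \<phi>) \<in> charts M" "p \<in> V" "smooth_near M p f"
  shows "((f \<circ> inv_into V \<phi>) has_derivative frechet_derivative (f \<circ> inv_into V \<phi>) (at (\<phi> p))) (at (\<phi> p))"
proof -
  obtain W where "p \<in> W" "smooth_fun M W f"
    using assms(3) unfolding smooth_near_def by blast
  then show ?thesis
    using smooth_on_has_derivative[OF smooth_fun_in_chart[OF _ assms(1)]] assms(2) by blast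
qed

lemma coord_vec_lincomb:
  assumes "(V, \<phi>) \<in> charts M" "p \<in> V"
  shows "coord_vec M V \<phi> (a *\<^sub>R w + b *\<^sub>R z) p
    = (\<lambda>f. a * coord_vec M V \<phi> w p f + b * coord_vec M V \<phi> z p f)"
proof
  fix f
  show "coord_vec M V \<phi> (a *\<^sub>R w + b *\<^sub>R z) p f
    = a * coord_vec M V \<phi> w p f + b * coord_vec M V \<phi> z p f"
  proof (cases "smooth_near M p f")
    case True
    from has_derivative_linear[OF chart_has_derivative[OF assms True]] show ?thesis
      using True by (simp add: coord_vec_def linear_add linear_cmul)
  qed (simp add: coord_vec_def)
qed

lemma coord_vec_tangent:
  assumes V: "(V, \<phi>) \<in> charts M" and p: "p \<in> V"
  shows "coord_vec M V \<phi> w p \<in> tangent M p"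
proof -
  let ?r = "\<lambda>f. f \<circ> inv_into V \<phi>"
  let ?D = "\<lambda>f. frechet_derivative (?r f) (at (\<phi> p))"
  have r: "?r f (\<phi> p) = f p" for f :: "'a \<Rightarrow> real"
    using chart_inj_on[OF V] p by simp
  have lincomb: "?D (\<lambda>x. a * f x + b * g x) w = a * ?D f w + b * ?D g w"
    if "smooth_near M p f" "smooth_near M p g" for f g a b
  proof -
    note D = chart_has_derivative[OF V p that(1)] chart_has_derivative[OF V p that(2)]
    have "(?r (\<lambda>x. a * f x + b * g x) has_derivative (\<lambda>w. a * ?D f w + b * ?D g w)) (at (\<phi> p))"
      using has_derivative_add[OF has_derivative_mult_right[OF D(1), of a] has_derivative_mult_right[OF D(2), of b]]
      by (simp add: o_def)
    from fun_cong[OF frechet_derivative_at[OF this], of w] show ?thesis by simp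
  qed
  have mult: "?D (\<lambda>x. f x * g x) w = f p * ?D g w + g p * ?D f w"
    if "smooth_near M p f" "smooth_near M p g" for f g
  proof -
    note D = chart_has_derivative[OF V p that(1)] chart_has_derivative[OF V p that(2)]
    have "(?r (\<lambda>x. f x * g x) has_derivative (\<lambda>w. f p * ?D g w + ?D f w * g p)) (at (\<phi> p))"
      using has_derivative_mult[OF D] unfolding r by (simp add: o_def)
    from fun_cong[OF frechet_derivative_at[OF this], of w] show ?thesis
      by (simp add: mult.commute[of "g p"])
  qed
  have loc: "?D f w = ?D g w"
    if f: "smooth_near M p f" and U: "openin (mtop M) U" "p \<in> U" "\<forall>x\<in>U. f x = g x" for f g U
  proof -
    have "\<phi> p \<in> \<phi> ` (U \<inter> V)" and "\<And>y. y \<in> \<phi> ` (U \<inter> V) \<Longrightarrow> ?r f y = ?r g y"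
      using chart_inj_on[OF V] p U by auto
    from has_derivative_transform_within_open[OF chart_has_derivative[OF V p f] chart_open_image[OF V U(1)] this]
    have "(?r g has_derivative ?D f) (at (\<phi> p))" .
    from fun_cong[OF frechet_derivative_at[OF this], of w] show ?thesis .
  qed
  show ?thesis
    unfolding tangent_def mem_Collect_eq coord_vec_def
  proof (intro conjI allI impI)
    fix f g :: "'a \<Rightarrow> real" and U
    assume "smooth_near M p f" "smooth_near M p g" "openin (mtop M) U" "p \<in> U" "\<forall>x\<in>U. f x = g x"
    then show "(if smooth_near M p f then ?D f w else 0) = (if smooth_near M p g then ?D g w else 0)"
      using loc[of f U g] by simp
  qed (simp_all add: lincomb mult smooth_near_lincomb smooth_near_mult)
qed

lemma coord_vec_field:
  assumes V: "(V, \<phi>) \<in> charts M"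
  shows "vector_field M V (coord_vec M V \<phi> w)"
  unfolding vector_field_def
proof (intro conjI allI impI ballI)
  show "openin (mtop M) V" using chart_openin[OF V] .
  show "coord_vec M V \<phi> w p \<in> tangent M p" if "p \<in> V" for p
    using coord_vec_tangent[OF V that] .
  fix W f assume W: "W \<subseteq> V" and f: "smooth_fun M W f"
  have "smooth_on (\<phi> ` W) (\<lambda>y. frechet_derivative (f \<circ> inv_into V \<phi>) (at y) w)"
    using smooth_on_frechet_derivative[OF smooth_fun_in_chart[OF f V]] W by (simp add: Int_absorb2)
  from smooth_fun_chart_comp[OF V smooth_fun_openin[OF f] W this]
  show "smooth_fun M W (\<lambda>p. coord_vec M V \<phi> w p f)"
    by (rule smooth_fun_cong) (simp add: coord_vec_def smooth_nearI[OF f])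
qed

text \<open>By Hadamard's lemma a function is, near \<open>p\<close>, a constant plus a sum of products of
  coordinate functions vanishing at \<open>p\<close> with smooth functions. A derivation is therefore
  determined by its values on the coordinate functions.\<close>

lemma tangent_eq_coord_vec:
  assumes V: "(V, \<phi>) \<in> charts M" and p: "p \<in> V" and v: "v \<in> tangent M p"
  shows "v = coord_vec M V \<phi> (\<Sum>b\<in>Basis. v (\<lambda>x. \<phi> x \<bullet> b) *\<^sub>R b) p"
proof
  fix f
  show "v f = coord_vec M V \<phi> (\<Sum>b\<in>Basis. v (\<lambda>x. \<phi> x \<bullet> b) *\<^sub>R b) p f"
  proof (cases "smooth_near M p f")
    case False
    then show ?thesis using tangent_not_smooth[OF v] by (simp add: coord_vec_def)
  next
    case True
    let ?F = "f \<circ> inv_into V \<phi>" and ?a = "\<phi> p"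
    obtain U where U: "p \<in> U" "smooth_fun M U f"
      using True unfolding smooth_near_def by blast
    have "open (\<phi> ` (U \<inter> V))" "?a \<in> \<phi> ` (U \<inter> V)"
      using chart_open_image[OF V smooth_fun_openin[OF U(2)]] U p by auto
    then obtain r where r: "r > 0" "ball ?a r \<subseteq> \<phi> ` (U \<inter> V)"
      using open_contains_ball by metis
    have "smooth_on (ball ?a r) ?F"
      using smooth_on_subset[OF smooth_fun_in_chart[OF U(2) V] r(2)] .
    then obtain G where G: "\<And>b. smooth_on (ball ?a r) (G b)"
      and Ga: "\<And>b. G b ?a = frechet_derivative ?F (at ?a) b"
      and F: "\<And>y. y \<in> ball ?a r \<Longrightarrow> ?F y = ?F ?a + (\<Sum>b\<in>Basis. ((y - ?a) \<bullet> b) * G b y)"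
      using Hadamard by blast
    define W where "W = {x \<in> V. \<phi> x \<in> ball ?a r}"
    have W: "openin (mtop M) W" "W \<subseteq> V" "p \<in> W" "\<phi> ` W \<subseteq> ball ?a r"
      using chart_openin_preimage[OF V, of "ball ?a r"] p r(1) by (auto simp: W_def)
    have top: "p \<in> topspace (mtop M)"
      using W openin_subset by blast
    have \<phi>W: "open (\<phi> ` W)"
      using chart_open_image[OF V W(1)] W(2) by (simp add: Int_absorb2)
    have sG: "smooth_near M p (\<lambda>x. G b (\<phi> x))" for b
      using smooth_nearI[OF smooth_fun_chart_comp[OF V W(1,2) smooth_on_subset[OF G W(4)]] W(3)]
      by (simp add: o_def)
    have sx: "smooth_near M p (\<lambda>x. \<phi> x \<bullet> b)" for b
      using smooth_nearI[OF smooth_fun_chart_comp[OF V W(1,2)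
            smooth_on_bounded_linear[OF \<phi>W bounded_linear_inner_left smooth_on_id]] W(3)]
      by (simp add: o_def)
    note sc = smooth_near_const[OF top]
    let ?t = "\<lambda>b x. (\<phi> x \<bullet> b - ?a \<bullet> b) * G b (\<phi> x)"
    have st: "smooth_near M p (?t b)" for b
      using smooth_near_mult[OF smooth_near_diff[OF sx sc] sG] .
    have vt: "v (?t b) = v (\<lambda>x. \<phi> x \<bullet> b) * G b ?a" for b
      using tangent_mult[OF v smooth_near_diff[OF sx sc] sG] tangent_diff[OF v sx sc] tangent_const[OF v top]
      by simp
    have S: "smooth_near M p (\<lambda>x. \<Sum>b\<in>Basis. ?t b x)"
      "v (\<lambda>x. \<Sum>b\<in>Basis. ?t b x) = (\<Sum>b\<in>Basis. v (?t b))"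
      using tangent_sum[OF v top finite_Basis, of ?t] st by blast+
    have "f x = ?F ?a + (\<Sum>b\<in>Basis. ?t b x)" if "x \<in> W" for x
      using F[of "\<phi> x"] that chart_inj_on[OF V] p by (auto simp: W_def inner_diff_left)
    then have "v f = v (\<lambda>x. ?F ?a + (\<Sum>b\<in>Basis. ?t b x))"
      by (rule tangent_cong[OF v True W(1,3)])
    also have "\<dots> = (\<Sum>b\<in>Basis. v (?t b))"
      using tangent_add[OF v sc S(1)] tangent_const[OF v top] S(2) by simp
    also have "\<dots> = (\<Sum>b\<in>Basis. v (\<lambda>x. \<phi> x \<bullet> b) * G b ?a)"
      by (simp only: vt)
    also have "\<dots> = frechet_derivative ?F (at ?a) (\<Sum>b\<in>Basis. v (\<lambda>x. \<phi> x \<bullet> b) *\<^sub>R b)"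
      using has_derivative_linear[OF chart_has_derivative[OF V p True]]
      by (simp add: linear_sum linear_cmul Ga)
    finally show ?thesis using True by (simp add: coord_vec_def)
  qed
qed

section \<open>Vector fields and Lie brackets\<close>

lemma vector_field_openin: "vector_field M U X \<Longrightarrow> openin (mtop M) U"
  by (simp add: vector_field_def)

lemma vector_field_tangent: "vector_field M U X \<Longrightarrow> p \<in> U \<Longrightarrow> X p \<in> tangent M p"
  by (simp add: vector_field_def)

lemma vector_field_smooth_fun:
  "vector_field M U X \<Longrightarrow> smooth_fun M W f \<Longrightarrow> W \<subseteq> U \<Longrightarrow> smooth_fun M W (\<lambda>p. X p f)"
  by (simp add: vector_field_def)

lemma vector_field_smooth_near:
  assumes X: "vector_field M U X" and p: "p \<in> U" and f: "smooth_near M p f"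
  shows "smooth_near M p (\<lambda>q. X q f)"
proof -
  obtain W where "p \<in> W" "W \<subseteq> U" "smooth_fun M W f"
    using smooth_near_restrict[OF f vector_field_openin[OF X] p] .
  then show ?thesis using smooth_nearI[OF vector_field_smooth_fun[OF X]] by blast
qed

lemma vector_field_subset:
  "vector_field M U X \<Longrightarrow> openin (mtop M) V \<Longrightarrow> V \<subseteq> U \<Longrightarrow> vector_field M V X"
  unfolding vector_field_def by (meson subset_iff subset_trans)

lemma vector_field_add_scaled:
  assumes X: "vector_field M U X" and Y: "vector_field M U Y" and h: "smooth_fun M U h"
  shows "vector_field M U (\<lambda>p f. X p f + h p * Y p f)"
  unfolding vector_field_def
proof (intro conjI allI impI ballI)
  show "openin (mtop M) U" using vector_field_openin[OF X] .
  show "(\<lambda>f. X p f + h p * Y p f) \<in> tangent M p" if "p \<in> U" for p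
    using tangent_combine[OF vector_field_tangent[OF X that] vector_field_tangent[OF Y that], of 1 "h p"]
    by simp
  fix V f assume V: "V \<subseteq> U" and f: "smooth_fun M V f"
  show "smooth_fun M V (\<lambda>p. X p f + h p * Y p f)"
    using V by (intro smooth_fun_add smooth_fun_mult vector_field_smooth_fun[OF X f]
        vector_field_smooth_fun[OF Y f] smooth_fun_subset[OF h smooth_fun_openin[OF f]])
qed

text \<open>The exterior derivatives \<open>d\<omega>\<close> and \<open>d\<Omega>\<close> are given by their values on vector fields; local
  extensions of vectors turn identities for these values into identities between forms at a point.\<close>

lemma tangent_vector_extends:
  assumes p: "p \<in> U" "openin (mtop M) U" and u: "u \<in> tangent M p"
  obtains V Y where "p \<in> V" "V \<subseteq> U" "vector_field M V Y" "Y p = u"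
proof -
  obtain V \<phi> where V: "(V, \<phi>) \<in> charts M" "p \<in> V"
    using chart_at openin_subset[OF p(2)] p(1) by blast
  define Y where "Y = coord_vec M V \<phi> (\<Sum>b\<in>Basis. u (\<lambda>x. \<phi> x \<bullet> b) *\<^sub>R b)"
  have "vector_field M (U \<inter> V) Y"
    using vector_field_subset[OF coord_vec_field[OF V(1)], of "U \<inter> V"] chart_openin[OF V(1)] p(2)
    unfolding Y_def by blast
  moreover have "Y p = u"
    using tangent_eq_coord_vec[OF V u] by (simp add: Y_def)
  ultimately show ?thesis using that[of "U \<inter> V" Y] p V by blast
qed

subsection \<open>Iterated derivatives\<close>

lemma iterated_lincomb:
  assumes v: "v \<in> tangent M p" and Y: "vector_field M U Y" and p: "p \<in> U"
    and fg: "smooth_near M p f" "smooth_near M p g"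
  shows "v (\<lambda>q. Y q (\<lambda>x. a * f x + b * g x)) = a * v (\<lambda>q. Y q f) + b * v (\<lambda>q. Y q g)"
proof -
  obtain W where W: "p \<in> W" "smooth_fun M W f" "smooth_fun M W g"
    using smooth_near_common[OF fg] .
  note Yf = vector_field_smooth_near[OF Y p fg(1)] and Yg = vector_field_smooth_near[OF Y p fg(2)]
  have "openin (mtop M) (W \<inter> U)"
    using smooth_fun_openin[OF W(2)] vector_field_openin[OF Y] by blast
  then have "v (\<lambda>q. a * Y q f + b * Y q g) = v (\<lambda>q. Y q (\<lambda>x. a * f x + b * g x))"
    using W p
    by (intro tangent_cong[OF v smooth_near_lincomb[OF Yf Yg], of "W \<inter> U"])
      (simp_all add: tangent_lincomb[OF vector_field_tangent[OF Y]] smooth_nearI[OF W(2)] smooth_nearI[OF W(3)])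
  then show ?thesis using tangent_lincomb[OF v Yf Yg] by simp
qed

lemma iterated_mult:
  assumes v: "v \<in> tangent M p" and Y: "vector_field M U Y" and p: "p \<in> U"
    and fg: "smooth_near M p f" "smooth_near M p g"
  shows "v (\<lambda>q. Y q (\<lambda>x. f x * g x))
    = f p * v (\<lambda>q. Y q g) + Y p g * v f + g p * v (\<lambda>q. Y q f) + Y p f * v g"
proof -
  obtain W where W: "p \<in> W" "smooth_fun M W f" "smooth_fun M W g"
    using smooth_near_common[OF fg] .
  note Yf = vector_field_smooth_near[OF Y p fg(1)] and Yg = vector_field_smooth_near[OF Y p fg(2)]
  note m = smooth_near_mult[OF fg(1) Yg] smooth_near_mult[OF fg(2) Yf]
  have "openin (mtop M) (W \<inter> U)"
    using smooth_fun_openin[OF W(2)] vector_field_openin[OF Y] by blast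
  then have "v (\<lambda>q. f q * Y q g + g q * Y q f) = v (\<lambda>q. Y q (\<lambda>x. f x * g x))"
    using W p
    by (intro tangent_cong[OF v smooth_near_add[OF m], of "W \<inter> U"])
      (simp_all add: tangent_mult[OF vector_field_tangent[OF Y]] smooth_nearI[OF W(2)] smooth_nearI[OF W(3)])
  then show ?thesis
    using tangent_add[OF v m] tangent_mult[OF v fg(1) Yg] tangent_mult[OF v fg(2) Yf] by simp
qed

lemma lie_bracket_apply:
  "smooth_near M p f \<Longrightarrow> lie_bracket M X Y p f = X p (\<lambda>q. Y q f) - Y p (\<lambda>q. X q f)"
  by (simp add: lie_bracket_def)

lemma lie_bracket_not_smooth: "\<not> smooth_near M p f \<Longrightarrow> lie_bracket M X Y p f = 0"
  by (simp add: lie_bracket_def)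

lemma lie_bracket_tangent:
  assumes X: "vector_field M U X" and Y: "vector_field M U Y" and p: "p \<in> U"
  shows "lie_bracket M X Y p \<in> tangent M p"
  unfolding tangent_def mem_Collect_eq
proof (intro conjI allI impI)
  note Xp = vector_field_tangent[OF X p] and Yp = vector_field_tangent[OF Y p]
  {
    fix f g :: "'a \<Rightarrow> real" and a b :: real
    assume fg: "smooth_near M p f" "smooth_near M p g"
    show "lie_bracket M X Y p (\<lambda>x. a * f x + b * g x) = a * lie_bracket M X Y p f + b * lie_bracket M X Y p g"
      using iterated_lincomb[OF Xp Y p fg] iterated_lincomb[OF Yp X p fg]
      by (simp add: lie_bracket_apply fg smooth_near_lincomb algebra_simps)
    show "lie_bracket M X Y p (\<lambda>x. f x * g x) = f p * lie_bracket M X Y p g + g p * lie_bracket M X Y p f"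
      using iterated_mult[OF Xp Y p fg] iterated_mult[OF Yp X p fg]
      by (simp add: lie_bracket_apply fg smooth_near_mult algebra_simps)
  next
    fix f g :: "'a \<Rightarrow> real" and V
    assume f: "smooth_near M p f" and g: "smooth_near M p g"
      and V: "openin (mtop M) V" "p \<in> V" and eq: "\<forall>x\<in>V. f x = g x"
    obtain W where W: "p \<in> W" "W \<subseteq> U \<inter> V" "smooth_fun M W f"
      using smooth_near_restrict[OF f, of "U \<inter> V"] vector_field_openin[OF X] V p by blast
    note oW = smooth_fun_openin[OF W(3)]
    have *: "Z q f = Z q g" if Z: "vector_field M U Z" and q: "q \<in> W" for Z q
    proof (rule tangent_cong[OF vector_field_tangent[OF Z] smooth_nearI[OF W(3) q] oW q])
      show "q \<in> U" using q W(2) by blast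
      show "f x = g x" if "x \<in> W" for x using that W(2) eq by blast
    qed
    have "X p (\<lambda>q. Y q f) = X p (\<lambda>q. Y q g)"
      by (rule tangent_cong[OF Xp vector_field_smooth_near[OF Y p f] oW W(1)]) (rule *[OF Y])
    moreover have "Y p (\<lambda>q. X q f) = Y p (\<lambda>q. X q g)"
      by (rule tangent_cong[OF Yp vector_field_smooth_near[OF X p f] oW W(1)]) (rule *[OF X])
    ultimately show "lie_bracket M X Y p f = lie_bracket M X Y p g"
      by (simp add: lie_bracket_apply f g)
  next
    show "lie_bracket M X Y p f = 0" if "\<not> smooth_near M p f" for f
      by (rule lie_bracket_not_smooth[OF that])
  }
qed

lemma lie_bracket_field:
  assumes X: "vector_field M U X" and Y: "vector_field M U Y"
  shows "vector_field M U (lie_bracket M X Y)"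
  unfolding vector_field_def
proof (intro conjI allI impI ballI)
  show "openin (mtop M) U" using vector_field_openin[OF X] .
  show "lie_bracket M X Y p \<in> tangent M p" if "p \<in> U" for p
    using lie_bracket_tangent[OF X Y that] .
  fix V f assume V: "V \<subseteq> U" and f: "smooth_fun M V f"
  have "smooth_fun M V (\<lambda>p. X p (\<lambda>q. Y q f) - Y p (\<lambda>q. X q f))"
    using V f by (intro smooth_fun_diff vector_field_smooth_fun[OF X] vector_field_smooth_fun[OF Y])
  then show "smooth_fun M V (\<lambda>p. lie_bracket M X Y p f)"
    by (rule smooth_fun_cong) (simp add: lie_bracket_apply smooth_nearI[OF f])
qed

lemma lie_bracket_cong:
  assumes X: "vector_field M U X" and Y: "vector_field M U Y" and p: "p \<in> U"
    and eq: "\<And>q. q \<in> U \<Longrightarrow> X q = X' q"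
  shows "lie_bracket M X Y p = lie_bracket M X' Y p"
proof
  fix f
  show "lie_bracket M X Y p f = lie_bracket M X' Y p f"
  proof (cases "smooth_near M p f")
    case True
    have "Y p (\<lambda>q. X q f) = Y p (\<lambda>q. X' q f)"
      by (rule tangent_cong[OF vector_field_tangent[OF Y p] vector_field_smooth_near[OF X p True]
            vector_field_openin[OF X] p]) (simp add: eq)
    then show ?thesis by (simp add: lie_bracket_apply True eq p)
  qed (simp add: lie_bracket_not_smooth)
qed

lemma tangent_apply_bracket:
  assumes v: "v \<in> tangent M p" and X: "vector_field M U X" and Y: "vector_field M U Y"
    and p: "p \<in> U" and f: "smooth_near M p f"
  shows "v (\<lambda>q. lie_bracket M X Y q f) = v (\<lambda>q. X q (\<lambda>r. Y r f)) - v (\<lambda>q. Y q (\<lambda>r. X r f))"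
proof -
  note XY = vector_field_smooth_near[OF X p vector_field_smooth_near[OF Y p f]]
  note YX = vector_field_smooth_near[OF Y p vector_field_smooth_near[OF X p f]]
  obtain W where W: "p \<in> W" "smooth_fun M W f"
    using f unfolding smooth_near_def by blast
  have "v (\<lambda>q. X q (\<lambda>r. Y r f) - Y q (\<lambda>r. X r f)) = v (\<lambda>q. lie_bracket M X Y q f)"
    by (rule tangent_cong[OF v smooth_near_diff[OF XY YX] smooth_fun_openin[OF W(2)] W(1)])
      (simp add: lie_bracket_apply smooth_nearI[OF W(2)])
  then show ?thesis using tangent_diff[OF v XY YX] by simp
qed

lemma Jacobi_identity:
  assumes X: "vector_field M U X" and Y: "vector_field M U Y" and Z: "vector_field M U Z" and p: "p \<in> U"
  shows "lie_bracket M (lie_bracket M X Y) Z p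
    = (\<lambda>f. lie_bracket M X (lie_bracket M Y Z) p f - lie_bracket M Y (lie_bracket M X Z) p f)"
proof
  fix f
  show "lie_bracket M (lie_bracket M X Y) Z p f
    = lie_bracket M X (lie_bracket M Y Z) p f - lie_bracket M Y (lie_bracket M X Z) p f"
  proof (cases "smooth_near M p f")
    case True
    note t = vector_field_tangent[OF X p] vector_field_tangent[OF Y p] vector_field_tangent[OF Z p]
    note s = vector_field_smooth_near[OF X p True] vector_field_smooth_near[OF Y p True]
      vector_field_smooth_near[OF Z p True]
    show ?thesis
      using tangent_apply_bracket[OF t(1) Y Z p True] tangent_apply_bracket[OF t(2) X Z p True]
        tangent_apply_bracket[OF t(3) X Y p True]
      by (simp add: lie_bracket_apply True s)
  qed (simp add: lie_bracket_not_smooth)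
qed

lemma lie_bracket_add_scaled:
  assumes X: "vector_field M U X" and E: "vector_field M U E" and Y: "vector_field M U Y"
    and h: "smooth_fun M U h" and p: "p \<in> U"
  shows "lie_bracket M (\<lambda>q f. X q f + h q * E q f) Y p
    = (\<lambda>f. (lie_bracket M X Y p f + h p * lie_bracket M E Y p f) - Y p h * E p f)"
proof
  fix f
  show "lie_bracket M (\<lambda>q f. X q f + h q * E q f) Y p f
    = (lie_bracket M X Y p f + h p * lie_bracket M E Y p f) - Y p h * E p f"
  proof (cases "smooth_near M p f")
    case True
    note h' = smooth_nearI[OF h p]
    note s = vector_field_smooth_near[OF X p True] vector_field_smooth_near[OF E p True]
    note Yp = vector_field_tangent[OF Y p]
    have "Y p (\<lambda>q. X q f + h q * E q f) = Y p (\<lambda>q. X q f) + (h p * Y p (\<lambda>q. E q f) + E p f * Y p h)"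
      using tangent_add[OF Yp s(1) smooth_near_mult[OF h' s(2)]] tangent_mult[OF Yp h' s(2)] by simp
    then show ?thesis by (simp add: lie_bracket_apply True algebra_simps)
  next
    case False
    then show ?thesis
      using tangent_not_smooth[OF vector_field_tangent[OF E p]] by (simp add: lie_bracket_not_smooth)
  qed
qed

section \<open>Covectors and the musical maps\<close>

lemma tangent_zero: "p \<in> topspace (mtop M) \<Longrightarrow> (\<lambda>f. 0) \<in> tangent M p"
  by (simp add: tangent_def)

lemma linear_fiber_lincomb:
  "linear_fiber S \<alpha> \<Longrightarrow> u \<in> S \<Longrightarrow> v \<in> S \<Longrightarrow> \<alpha> (\<lambda>x. a * u x + b * v x) = a * \<alpha> u + b * \<alpha> v"
  by (simp add: linear_fiber_def)

lemma linear_fiber_sum: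
  assumes \<alpha>: "linear_fiber S \<alpha>" and zero: "(\<lambda>x. 0) \<in> S"
    and comb: "\<And>u v a b. u \<in> S \<Longrightarrow> v \<in> S \<Longrightarrow> (\<lambda>x. a * u x + b * v x) \<in> S"
    and "finite I" "\<And>i. i \<in> I \<Longrightarrow> s i \<in> S"
  shows "(\<lambda>x. \<Sum>i\<in>I. c i * s i x) \<in> S \<and> \<alpha> (\<lambda>x. \<Sum>i\<in>I. c i * s i x) = (\<Sum>i\<in>I. c i * \<alpha> (s i))"
  using assms(4,5)
proof (induction I rule: finite_induct)
  case empty
  show ?case
    using linear_fiber_lincomb[OF \<alpha> zero zero, of 0 0] zero by simp
next
  case (insert i I)
  then have *: "s i \<in> S" "(\<lambda>x. \<Sum>i\<in>I. c i * s i x) \<in> S" by simp_all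
  show ?case
    using insert comb[OF *, of "c i" 1] linear_fiber_lincomb[OF \<alpha> *, of "c i" 1] by simp
qed

lemma cotangent_linear_fiber: "\<alpha> \<in> cotangent M p \<Longrightarrow> linear_fiber (tangent M p) \<alpha>"
  by (simp add: cotangent_def)

lemma cotangent_combine:
  assumes "\<alpha> \<in> cotangent M p" "\<beta> \<in> cotangent M p"
  shows "(\<lambda>v. a * \<alpha> v + b * \<beta> v) \<in> cotangent M p"
  using assms by (simp add: cotangent_def linear_fiber_def algebra_simps)

lemma cotangent_zero: "(\<lambda>v. 0) \<in> cotangent M p"
  by (simp add: cotangent_def linear_fiber_def)

lemma differential_cotangent: "differential M f p \<in> cotangent M p"
  using tangent_combine by (simp add: cotangent_def linear_fiber_def differential_def)

lemma linear_coord_vec: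
  assumes V: "(V, \<phi>) \<in> charts M" "p \<in> V" and \<alpha>: "linear_fiber (tangent M p) \<alpha>"
  shows "linear (\<lambda>w. \<alpha> (coord_vec M V \<phi> w p))"
proof (rule linearI)
  note L = linear_fiber_lincomb[OF \<alpha> coord_vec_tangent[OF V] coord_vec_tangent[OF V]]
  show "\<alpha> (coord_vec M V \<phi> (x + y) p) = \<alpha> (coord_vec M V \<phi> x p) + \<alpha> (coord_vec M V \<phi> y p)" for x y
    using L[of 1 x 1 y] coord_vec_lincomb[OF V, of 1 x 1 y] by simp
  show "\<alpha> (coord_vec M V \<phi> (c *\<^sub>R x) p) = c *\<^sub>R \<alpha> (coord_vec M V \<phi> x p)" for c x
    using L[of c x 0 x] coord_vec_lincomb[OF V, of c x 0 x] by simp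
qed

lemma linear_fiber_coord_expansion:
  assumes V: "(V, \<phi>) \<in> charts M" "p \<in> V" and \<alpha>: "linear_fiber (tangent M p) \<alpha>"
  shows "\<alpha> (coord_vec M V \<phi> w p) = (\<Sum>b\<in>Basis. (w \<bullet> b) * \<alpha> (coord_vec M V \<phi> b p))"
  using linear_Basis_expansion[OF linear_coord_vec[OF assms], of w] by simp

text \<open>The tangent space is finite-dimensional, hence reflexive; it is therefore meaningful to
  determine a tangent vector through its pairing with covectors.\<close>

lemma tangent_reflexive:
  assumes p: "p \<in> topspace (mtop M)" and L: "linear_fiber (cotangent M p) L"
  shows "\<exists>!v. v \<in> tangent M p \<and> (\<forall>\<beta>\<in>cotangent M p. \<beta> v = L \<beta>)"
proof (rule ex_ex1I)
  obtain V \<phi> where V: "(V, \<phi>) \<in> charts M" "p \<in> V"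
    using chart_at[OF p] .
  let ?x = "\<lambda>b x. \<phi> x \<bullet> b"
  let ?w = "\<Sum>b\<in>Basis. L (differential M (?x b) p) *\<^sub>R b"
  let ?v = "coord_vec M V \<phi> ?w p"
  have "\<beta> ?v = L \<beta>" if \<beta>: "\<beta> \<in> cotangent M p" for \<beta>
  proof -
    note ex = linear_fiber_coord_expansion[OF V cotangent_linear_fiber[OF \<beta>]]
    let ?c = "\<lambda>b. \<beta> (coord_vec M V \<phi> b p)"
    have "\<beta> u = (\<Sum>b\<in>Basis. ?c b * differential M (?x b) p u)" for u
    proof (cases "u \<in> tangent M p")
      case True
      have "\<beta> u = \<beta> (coord_vec M V \<phi> (\<Sum>b\<in>Basis. u (?x b) *\<^sub>R b) p)"
        using tangent_eq_coord_vec[OF V True] by (rule arg_cong)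
      also have "\<dots> = (\<Sum>b\<in>Basis. ?c b * u (?x b))"
        by (subst ex) (simp add: mult.commute)
      finally show ?thesis using True by (simp add: differential_def)
    next
      case False
      then show ?thesis using \<beta> by (simp add: cotangent_def differential_def)
    qed
    then have "L \<beta> = L (\<lambda>u. \<Sum>b\<in>Basis. ?c b * differential M (?x b) p u)"
      by (intro arg_cong[of _ _ L] ext)
    also have "\<dots> = (\<Sum>b\<in>Basis. ?c b * L (differential M (?x b) p))"
      using linear_fiber_sum[OF L cotangent_zero cotangent_combine finite_Basis differential_cotangent]
      by (rule conjunct2)
    also have "\<dots> = \<beta> ?v"
      by (subst ex) (simp add: mult.commute)
    finally show ?thesis by simp
  qed
  then show "\<exists>v. v \<in> tangent M p \<and> (\<forall>\<beta>\<in>cotangent M p. \<beta> v = L \<beta>)"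
    using coord_vec_tangent[OF V] by blast
next
  fix u v
  assume u: "u \<in> tangent M p \<and> (\<forall>\<beta>\<in>cotangent M p. \<beta> u = L \<beta>)"
    and v: "v \<in> tangent M p \<and> (\<forall>\<beta>\<in>cotangent M p. \<beta> v = L \<beta>)"
  have "u f = v f" for f
  proof -
    have "differential M f p u = differential M f p v"
      using u v differential_cotangent by simp
    then show ?thesis using u v by (simp add: differential_def)
  qed
  then show "u = v" by (rule ext)
qed

text \<open>In coordinates a common degenerate direction of \<open>\<omega>\<close> and \<open>\<Omega>\<close> would make
  \<open>\<omega> \<and> \<Omega>\<^sup>n\<close> vanish.\<close>

lemma nondegenerate_pair:
  assumes dim: "DIM('b) = 2 * n + 1" and p: "p \<in> topspace (mtop M)"
    and \<omega>: "linear_fiber (tangent M p) \<omega>"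
    and \<Omega>: "\<And>u. u \<in> tangent M p \<Longrightarrow> linear_fiber (tangent M p) (\<Omega> u)"
    and skew: "\<And>u v. u \<in> tangent M p \<Longrightarrow> v \<in> tangent M p \<Longrightarrow> \<Omega> u v = - \<Omega> v u"
    and v: "\<And>i. i < 2 * n + 1 \<Longrightarrow> v i \<in> tangent M p"
      "wedge 1 (2 * n) (\<lambda>v. \<omega> (v 0)) (wedge_power \<Omega> n) v \<noteq> 0"
    and u: "u \<in> tangent M p" "\<omega> u = 0" "\<And>w. w \<in> tangent M p \<Longrightarrow> \<Omega> u w = 0"
  shows "u = (\<lambda>f. 0)"
proof (rule ccontr)
  assume "u \<noteq> (\<lambda>f. 0)"
  obtain V \<phi> where V: "(V, \<phi>) \<in> charts M" "p \<in> V"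
    using chart_at[OF p] .
  \<comment> \<open>\<open>A\<close> transports the problem to the model space, and \<open>C\<close> is a right inverse of \<open>A\<close>.\<close>
  define A where "A w = coord_vec M V \<phi> w p" for w
  define C where "C v = (\<Sum>b\<in>Basis. v (\<lambda>x. \<phi> x \<bullet> b) *\<^sub>R b)" for v :: "'a tvec"
  have A: "A w \<in> tangent M p" for w
    using coord_vec_tangent[OF V] by (simp add: A_def)
  have AC: "A (C v) = v" if "v \<in> tangent M p" for v
    using tangent_eq_coord_vec[OF V that] by (simp add: A_def C_def)
  have lin: "linear (\<lambda>w. \<alpha> (A w))" if "linear_fiber (tangent M p) \<alpha>" for \<alpha>
    using linear_coord_vec[OF V that] by (simp add: A_def)
  have lin2: "linear (\<lambda>x. \<Omega> (A x) (A y))" for y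
  proof -
    have "linear (\<lambda>x. - \<Omega> (A y) (A x))"
      using lin[OF \<Omega>[OF A[of y]]] by (rule linear_compose_neg)
    moreover have "(\<lambda>x. - \<Omega> (A y) (A x)) = (\<lambda>x. \<Omega> (A x) (A y))"
      by (intro ext) (rule skew[OF A A, symmetric])
    ultimately show ?thesis by simp
  qed
  have "A 0 = (\<lambda>f. 0)"
    using coord_vec_lincomb[OF V, of 0 0 0 0] by (simp add: A_def)
  then have Cu: "C u \<noteq> 0"
    using AC[OF u(1)] \<open>u \<noteq> (\<lambda>f. 0)\<close> by metis
  define y where "y i = C (v i)" for i
  have pullback: "wedge_power \<Omega> n (\<lambda>i. A (z i)) = wedge_power (\<lambda>x y. \<Omega> (A x) (A y)) n z" for z
    by (rule wedge_power_pullback)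
  have "wedge 1 (2 * n) (\<lambda>v. \<omega> (v 0)) (wedge_power \<Omega> n) v
      = wedge 1 (2 * n) (\<lambda>v. \<omega> (v 0)) (wedge_power \<Omega> n) (\<lambda>i. A (y i))"
  proof (rule wedge_cong)
    show "v i = A (y i)" if "i < 1 + 2 * n" for i
      using that by (simp add: y_def AC v(1))
  qed (simp, erule wedge_power_cong)
  also have "\<dots> = wedge 1 (2 * n) (\<lambda>v. \<omega> (A (v 0))) (wedge_power (\<lambda>x y. \<Omega> (A x) (A y)) n) y"
    unfolding wedge_def pullback ..
  also have "\<dots> = 0"
  proof (rule wedge_eq_0_if_degenerate[OF dim lin[OF \<omega>] lin[OF \<Omega>[OF A]] lin2 Cu])
    show "\<omega> (A (C u)) = 0" "\<Omega> (A (C u)) (A z) = 0" "\<Omega> (A z) (A (C u)) = 0" for z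
      unfolding AC[OF u(1)] skew[OF A[of z] u(1)] by (simp_all add: u A)
  qed
  finally show False using v(2) by simp
qed

end

section \<open>Almost-cosymplectic-contact manifolds\<close>

locale acc_mfd = smooth_mfd M
  for M :: "('a, 'b::euclidean_space) charted_space" +
  fixes n :: nat
    and \<omega> :: "'a \<Rightarrow> 'a covec"
    and \<Omega> :: "'a \<Rightarrow> 'a tvec \<Rightarrow> 'a tvec \<Rightarrow> real"
    and E :: "'a \<Rightarrow> 'a tvec"
    and \<Lambda> :: "'a \<Rightarrow> 'a covec \<Rightarrow> 'a covec \<Rightarrow> real"
  assumes dimension: "DIM('b) = 2 * n + 1"
    and acc: "acc_structure M n \<omega> \<Omega>"
    and dual: "dual_structure M \<omega> \<Omega> E \<Lambda>"
begin

subsection \<open>Linear algebra at a point\<close>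

lemma omega_one_form: "one_form M (topspace (mtop M)) \<omega>"
  and Omega_two_form: "two_form M (topspace (mtop M)) \<Omega>"
  and Omega_closed: "closed_two_form M \<Omega>"
  using acc by (simp_all add: acc_structure_def)

lemma E_field: "vector_field M (topspace (mtop M)) E"
  and Lambda_two_vector: "two_vector_field M (topspace (mtop M)) \<Lambda>"
  using dual by (simp_all add: dual_structure_def)

lemma E_field_on: "openin (mtop M) U \<Longrightarrow> vector_field M U E"
  using vector_field_subset[OF E_field] openin_subset by blast

context
  fixes p assumes p: "p \<in> topspace (mtop M)"
begin

lemma omega_cotangent: "\<omega> p \<in> cotangent M p"
  using omega_one_form p by (simp add: one_form_def)

lemma E_tangent: "E p \<in> tangent M p"
  using vector_field_tangent[OF E_field p] .

lemma omega_E: "\<omega> p (E p) = 1"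
  using dual p by (simp add: dual_structure_def)

lemma Omega_linear: "u \<in> tangent M p \<Longrightarrow> linear_fiber (tangent M p) (\<Omega> p u)"
  using Omega_two_form p by (simp add: two_form_def)

lemma Omega_skew: "u \<in> tangent M p \<Longrightarrow> v \<in> tangent M p \<Longrightarrow> \<Omega> p u v = - \<Omega> p v u"
  using Omega_two_form p unfolding two_form_def by blast

lemma Omega_linear_left:
  assumes "u \<in> tangent M p" "v \<in> tangent M p" "w \<in> tangent M p"
  shows "\<Omega> p (\<lambda>f. a * u f + b * v f) w = a * \<Omega> p u w + b * \<Omega> p v w"
  using linear_fiber_lincomb[OF Omega_linear[OF assms(3)] assms(1,2), of a b]
    Omega_skew[OF tangent_combine[OF assms(1,2)] assms(3), of a b]
    Omega_skew[OF assms(1,3)] Omega_skew[OF assms(2,3)] by simp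

lemma Omega_E:
  assumes "v \<in> tangent M p"
  shows "\<Omega> p (E p) v = 0"
proof -
  have "flat M \<Omega> p (E p) = (\<lambda>v. 0)"
    using dual p by (simp add: dual_structure_def)
  then have "flat M \<Omega> p (E p) v = 0" by (rule fun_cong)
  then show ?thesis using assms by (simp add: flat_def)
qed

lemma kernel_trivial:
  assumes "u \<in> tangent M p" "\<omega> p u = 0" "\<And>w. w \<in> tangent M p \<Longrightarrow> \<Omega> p u w = 0"
  shows "u = (\<lambda>f. 0)"
proof -
  obtain v where "\<forall>i<2 * n + 1. v i \<in> tangent M p"
    "wedge 1 (2 * n) (\<lambda>v. \<omega> p (v 0)) (wedge_power (\<Omega> p) n) v \<noteq> 0"
    using acc p unfolding acc_structure_def by blast
  then show ?thesis
    using assms by (intro nondegenerate_pair[OF dimension p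
          cotangent_linear_fiber[OF omega_cotangent] Omega_linear Omega_skew]) auto
qed

lemma flat_cotangent: "u \<in> tangent M p \<Longrightarrow> flat M \<Omega> p u \<in> cotangent M p"
  using Omega_linear tangent_combine by (simp add: cotangent_def flat_def linear_fiber_def)

lemma Lambda_linear: "\<alpha> \<in> cotangent M p \<Longrightarrow> linear_fiber (cotangent M p) (\<Lambda> p \<alpha>)"
  using Lambda_two_vector p by (simp add: two_vector_field_def)

lemma Lambda_skew: "\<alpha> \<in> cotangent M p \<Longrightarrow> \<beta> \<in> cotangent M p \<Longrightarrow> \<Lambda> p \<alpha> \<beta> = - \<Lambda> p \<beta> \<alpha>"
  using Lambda_two_vector p unfolding two_vector_field_def by blast

lemma sharp_characterization:
  assumes "\<alpha> \<in> cotangent M p"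
  shows sharp_tangent: "sharp M \<Lambda> p \<alpha> \<in> tangent M p"
    and sharp_pairing: "\<beta> \<in> cotangent M p \<Longrightarrow> \<beta> (sharp M \<Lambda> p \<alpha>) = \<Lambda> p \<alpha> \<beta>"
proof -
  have "sharp M \<Lambda> p \<alpha> \<in> tangent M p \<and> (\<forall>\<beta>\<in>cotangent M p. \<beta> (sharp M \<Lambda> p \<alpha>) = \<Lambda> p \<alpha> \<beta>)"
    unfolding sharp_def by (rule theI'[OF tangent_reflexive[OF p Lambda_linear[OF assms]]])
  then show "sharp M \<Lambda> p \<alpha> \<in> tangent M p"
    and "\<beta> \<in> cotangent M p \<Longrightarrow> \<beta> (sharp M \<Lambda> p \<alpha>) = \<Lambda> p \<alpha> \<beta>" by simp_all
qed

lemma omega_sharp: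
  assumes "\<alpha> \<in> cotangent M p"
  shows "\<omega> p (sharp M \<Lambda> p \<alpha>) = 0"
proof -
  have "sharp M \<Lambda> p (\<omega> p) = (\<lambda>f. 0)"
    using dual p by (simp add: dual_structure_def)
  moreover have "\<alpha> (\<lambda>f. 0) = 0"
    using linear_fiber_lincomb[OF cotangent_linear_fiber[OF assms] tangent_zero[OF p] tangent_zero[OF p], of 0 0]
    by simp
  ultimately have "\<Lambda> p (\<omega> p) \<alpha> = 0"
    using sharp_pairing[OF omega_cotangent assms] by simp
  then show ?thesis
    using sharp_pairing[OF assms omega_cotangent] Lambda_skew[OF assms omega_cotangent] by simp
qed

lemma flat_sharp_flat:
  assumes "u \<in> tangent M p"
  shows "flat M \<Omega> p (sharp M \<Lambda> p (flat M \<Omega> p u)) = flat M \<Omega> p u"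
proof -
  let ?S = "sharp M \<Lambda> p ` cotangent M p" and ?F = "flat M \<Omega> p ` tangent M p"
  have bij: "bij_betw (flat M \<Omega> p) ?S ?F"
    and inv: "\<forall>\<alpha>\<in>?F. the_inv_into ?S (flat M \<Omega> p) \<alpha> = sharp M \<Lambda> p \<alpha>"
    using dual p by (simp_all add: dual_structure_def Let_def)
  have u: "flat M \<Omega> p u \<in> ?F" using assms by (rule imageI)
  have "flat M \<Omega> p (the_inv_into ?S (flat M \<Omega> p) (flat M \<Omega> p u)) = flat M \<Omega> p u"
    using f_the_inv_into_f_bij_betw[OF bij] u by blast
  then show ?thesis using bspec[OF inv u] by simp
qed

text \<open>The difference of the two sides lies in the kernels of both \<open>\<omega>\<close> and \<open>\<Omega>\<close>.\<close>

lemma sharp_flat: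
  assumes u: "u \<in> tangent M p"
  shows "sharp M \<Lambda> p (flat M \<Omega> p u) = (\<lambda>f. u f - \<omega> p u * E p f)"
proof -
  let ?s = "sharp M \<Lambda> p (flat M \<Omega> p u)"
  let ?t = "\<lambda>f. 1 * u f + (- \<omega> p u) * E p f"
  let ?w = "\<lambda>f. 1 * ?t f + (-1) * ?s f"
  note s = sharp_tangent[OF flat_cotangent[OF u]]
  note t = tangent_combine[OF u E_tangent, of 1 "- \<omega> p u"]
  note L = linear_fiber_lincomb[OF cotangent_linear_fiber[OF omega_cotangent]]
  have "\<omega> p ?w = 0"
    using L[OF t s, of 1 "-1"] L[OF u E_tangent, of 1 "- \<omega> p u"] omega_sharp[OF flat_cotangent[OF u]] omega_E
    by simp
  moreover have "\<Omega> p ?w z = 0" if z: "z \<in> tangent M p" for z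
  proof -
    have "\<Omega> p ?s z = \<Omega> p u z"
      using fun_cong[OF flat_sharp_flat[OF u], of z] z by (simp add: flat_def)
    then show ?thesis
      using Omega_linear_left[OF t s z, of 1 "-1"] Omega_linear_left[OF u E_tangent z, of 1 "- \<omega> p u"] Omega_E[OF z]
      by simp
  qed
  ultimately have "?w = (\<lambda>f. 0)"
    by (intro kernel_trivial tangent_combine[OF t s])
  then have "?w f = 0" for f by (rule fun_cong)
  then show ?thesis by (intro ext) (simp add: algebra_simps)
qed

text \<open>That is, \<open>\<Omega>\<^sup>\<flat>(\<alpha>\<^sup>\<sharp>) = \<alpha> - \<alpha>(E) \<omega>\<close>: by skew-symmetry of \<open>\<Lambda>\<close> and \<open>\<Omega>\<close> the endomorphism
  \<open>\<alpha> \<mapsto> \<Omega>\<^sup>\<flat>(\<alpha>\<^sup>\<sharp>)\<close> of the cotangent space is the transpose of \<open>u \<mapsto> (\<Omega>\<^sup>\<flat>(u))\<^sup>\<sharp>\<close>.\<close>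

lemma Omega_sharp:
  assumes \<alpha>: "\<alpha> \<in> cotangent M p" and u: "u \<in> tangent M p"
  shows "\<Omega> p (sharp M \<Lambda> p \<alpha>) u = \<alpha> u - \<alpha> (E p) * \<omega> p u"
proof -
  note s = sharp_tangent[OF \<alpha>] and fl = flat_cotangent[OF u]
  have "\<Omega> p (sharp M \<Lambda> p \<alpha>) u = - flat M \<Omega> p u (sharp M \<Lambda> p \<alpha>)"
    using Omega_skew[OF s u] s by (simp add: flat_def)
  also have "\<dots> = - \<Lambda> p \<alpha> (flat M \<Omega> p u)"
    using sharp_pairing[OF \<alpha> fl] by simp
  also have "\<dots> = \<alpha> (sharp M \<Lambda> p (flat M \<Omega> p u))"
    using Lambda_skew[OF \<alpha> fl] sharp_pairing[OF fl \<alpha>] by simp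
  also have "\<dots> = \<alpha> u - \<alpha> (E p) * \<omega> p u"
    using linear_fiber_lincomb[OF cotangent_linear_fiber[OF \<alpha>] u E_tangent, of 1 "- \<omega> p u"]
    by (simp add: sharp_flat[OF u])
  finally show ?thesis .
qed

end

subsection \<open>Pre-Hamiltonian lifts\<close>

lemma preham_lift_apply: "preham_lift M E \<Lambda> (f, h) = (\<lambda>p g. ham_field M \<Lambda> f p g + h p * E p g)"
  by (simp add: preham_lift_def)

lemma differential_one_form:
  assumes f: "smooth_fun M U f"
  shows "one_form M U (differential M f)"
  unfolding one_form_def
proof (intro conjI allI impI ballI)
  show "openin (mtop M) U" using smooth_fun_openin[OF f] .
  show "differential M f p \<in> cotangent M p" for p by (rule differential_cotangent)
  fix V X assume V: "V \<subseteq> U" and X: "vector_field M V X"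
  have "smooth_fun M V f" using smooth_fun_subset[OF f vector_field_openin[OF X] V] .
  then have "smooth_fun M V (\<lambda>p. X p f)"
    by (rule vector_field_smooth_fun[OF X]) simp
  then show "smooth_fun M V (\<lambda>p. differential M f p (X p))"
    by (rule smooth_fun_cong) (simp add: differential_def vector_field_tangent[OF X])
qed

lemma ham_field_tangent: "p \<in> topspace (mtop M) \<Longrightarrow> ham_field M \<Lambda> f p \<in> tangent M p"
  unfolding ham_field_def by (rule sharp_tangent[OF _ differential_cotangent])

lemma ham_field_eq:
  assumes "p \<in> topspace (mtop M)"
  shows "ham_field M \<Lambda> f p g = \<Lambda> p (differential M f p) (differential M g p)"
proof -
  have "differential M g p (ham_field M \<Lambda> f p) = \<Lambda> p (differential M f p) (differential M g p)"
    unfolding ham_field_def by (rule sharp_pairing[OF assms differential_cotangent differential_cotangent])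
  moreover have "differential M g p (ham_field M \<Lambda> f p) = ham_field M \<Lambda> f p g"
    by (simp add: differential_def[of M g] ham_field_tangent[OF assms])
  ultimately show ?thesis by simp
qed

lemma ham_field_vector_field:
  assumes f: "smooth_fun M U f"
  shows "vector_field M U (ham_field M \<Lambda> f)"
  unfolding vector_field_def
proof (intro conjI allI impI ballI)
  note U = openin_subset[OF smooth_fun_openin[OF f]]
  show "openin (mtop M) U" using smooth_fun_openin[OF f] .
  show "ham_field M \<Lambda> f p \<in> tangent M p" if "p \<in> U" for p
    using ham_field_tangent U that by blast
  fix V g assume V: "V \<subseteq> U" and g: "smooth_fun M V g"
  have "smooth_fun M V f" using smooth_fun_subset[OF f smooth_fun_openin[OF g] V] .
  note forms = differential_one_form[OF this] differential_one_form[OF g]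
  have "\<forall>V \<alpha> \<beta>. V \<subseteq> topspace (mtop M) \<longrightarrow> one_form M V \<alpha> \<longrightarrow> one_form M V \<beta> \<longrightarrow>
      smooth_fun M V (\<lambda>p. \<Lambda> p (\<alpha> p) (\<beta> p))"
    using Lambda_two_vector unfolding two_vector_field_def by (elim conjE) assumption
  with forms U V have "smooth_fun M V (\<lambda>p. \<Lambda> p (differential M f p) (differential M g p))"
    by (meson subset_trans)
  then show "smooth_fun M V (\<lambda>p. ham_field M \<Lambda> f p g)"
  proof (rule smooth_fun_cong)
    fix p assume "p \<in> V"
    then have "p \<in> topspace (mtop M)" using U V by blast
    then show "\<Lambda> p (differential M f p) (differential M g p) = ham_field M \<Lambda> f p g"
      by (rule ham_field_eq[symmetric])
  qed
qed

lemma preham_lift_vector_field: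
  assumes "smooth_fun M U f" "smooth_fun M U h"
  shows "vector_field M U (preham_lift M E \<Lambda> (f, h))"
  unfolding preham_lift_apply
  using assms by (intro vector_field_add_scaled ham_field_vector_field E_field_on smooth_fun_openin[of U f])

lemma omega_smooth:
  assumes Y: "vector_field M V Y"
  shows "smooth_fun M V (\<lambda>q. \<omega> q (Y q))"
proof -
  have "\<forall>V X. V \<subseteq> topspace (mtop M) \<longrightarrow> vector_field M V X \<longrightarrow> smooth_fun M V (\<lambda>p. \<omega> p (X p))"
    using omega_one_form unfolding one_form_def by (elim conjE) assumption
  then show ?thesis using Y openin_subset[OF vector_field_openin[OF Y]] by simp
qed

lemma omega_ham_field: "p \<in> topspace (mtop M) \<Longrightarrow> \<omega> p (ham_field M \<Lambda> f p) = 0"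
  unfolding ham_field_def by (rule omega_sharp[OF _ differential_cotangent])

lemma omega_preham_lift:
  assumes p: "p \<in> topspace (mtop M)"
  shows "\<omega> p (preham_lift M E \<Lambda> (f, h) p) = h p"
  using linear_fiber_lincomb[OF cotangent_linear_fiber[OF omega_cotangent[OF p]]
      ham_field_tangent[OF p] E_tangent[OF p], of 1 f "h p"]
  by (simp add: preham_lift_apply omega_E[OF p] omega_ham_field[OF p])

lemma Omega_preham_lift:
  assumes p: "p \<in> topspace (mtop M)" and u: "u \<in> tangent M p"
  shows "\<Omega> p (preham_lift M E \<Lambda> (f, h) p) u = u f - E p f * \<omega> p u"
proof -
  have "\<Omega> p (ham_field M \<Lambda> f p) u = u f - E p f * \<omega> p u"
    using Omega_sharp[OF p differential_cotangent u] u E_tangent[OF p]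
    by (simp add: ham_field_def differential_def)
  then show ?thesis
    using Omega_linear_left[OF p ham_field_tangent[OF p] E_tangent[OF p] u, of 1 f "h p"] Omega_E[OF p u]
    by (simp add: preham_lift_apply)
qed

text \<open>The left-hand side is the 1-form that defines \<open>LGen\<close>, the right-hand side is
  \<open>(L\<^sub>X \<omega>)(Y)\<close> for the lift \<open>X\<close>. In Cartan's formula the term \<open>d(i\<^sub>X \<omega>)\<close> is \<open>dh\<close>.\<close>

lemma LGen_form_eq_Lie_derivative:
  assumes f: "smooth_fun M U f" and h: "smooth_fun M U h"
    and V: "V \<subseteq> U" and Y: "vector_field M V Y" and p: "p \<in> V"
  shows "d_one_form M \<omega> (ham_field M \<Lambda> f) Y p + h p * d_one_form M \<omega> E Y p + differential M h p (Y p)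
    = preham_lift M E \<Lambda> (f, h) p (\<lambda>q. \<omega> q (Y q)) - \<omega> p (lie_bracket M (preham_lift M E \<Lambda> (f, h)) Y p)"
proof -
  note oV = vector_field_openin[OF Y]
  have top: "p \<in> topspace (mtop M)" using openin_subset[OF oV] p by blast
  have hV: "smooth_fun M V h" and HV: "vector_field M V (ham_field M \<Lambda> f)"
    using smooth_fun_subset[OF h oV V] ham_field_vector_field[OF smooth_fun_subset[OF f oV V]] .
  note EV = E_field_on[OF oV]
  note Yp = vector_field_tangent[OF Y p]
  have 0: "Y p (\<lambda>q. \<omega> q (ham_field M \<Lambda> f q)) = 0"
    using tangent_cong[OF Yp smooth_near_const[OF top] openin_topspace top, of 0 "\<lambda>q. \<omega> q (ham_field M \<Lambda> f q)"]
      tangent_const[OF Yp top] omega_ham_field by simp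
  have 1: "Y p (\<lambda>q. \<omega> q (E q)) = 0"
    using tangent_cong[OF Yp smooth_near_const[OF top] openin_topspace top, of 1 "\<lambda>q. \<omega> q (E q)"]
      tangent_const[OF Yp top] omega_E by simp
  note L = linear_fiber_lincomb[OF cotangent_linear_fiber[OF omega_cotangent[OF top]]]
  note A = lie_bracket_tangent[OF HV Y p] and B = lie_bracket_tangent[OF EV Y p]
  have "\<omega> p (lie_bracket M (preham_lift M E \<Lambda> (f, h)) Y p)
      = \<omega> p (lie_bracket M (ham_field M \<Lambda> f) Y p) + h p * \<omega> p (lie_bracket M E Y p) - Y p h"
    using L[OF tangent_combine[OF A B, of 1 "h p"] E_tangent[OF top], of 1 "- Y p h"] L[OF A B, of 1 "h p"]
    by (simp add: preham_lift_apply lie_bracket_add_scaled[OF HV EV Y hV p] omega_E[OF top])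
  then show ?thesis
    by (simp add: d_one_form_def 0 1 differential_def Yp preham_lift_apply algebra_simps)
qed

lemma LGen_iff:
  "(f, h) \<in> LGen M \<omega> E \<Lambda> U \<longleftrightarrow> smooth_fun M U f \<and> smooth_fun M U h \<and>
    (\<forall>V Y. V \<subseteq> U \<longrightarrow> vector_field M V Y \<longrightarrow> (\<forall>p\<in>V. preham_lift M E \<Lambda> (f, h) p (\<lambda>q. \<omega> q (Y q))
      = \<omega> p (lie_bracket M (preham_lift M E \<Lambda> (f, h)) Y p)))"
proof (cases "smooth_fun M U f \<and> smooth_fun M U h")
  case True
  then have "d_one_form M \<omega> (ham_field M \<Lambda> f) Y p + h p * d_one_form M \<omega> E Y p + differential M h p (Y p) = 0
    \<longleftrightarrow> preham_lift M E \<Lambda> (f, h) p (\<lambda>q. \<omega> q (Y q)) = \<omega> p (lie_bracket M (preham_lift M E \<Lambda> (f, h)) Y p)"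
    if "V \<subseteq> U" "vector_field M V Y" "p \<in> V" for V Y p
    using LGen_form_eq_Lie_derivative[of U f h V Y p] that by simp
  with True show ?thesis unfolding LGen_def by simp
qed (auto simp: LGen_def)

subsection \<open>The bracket of two lifts\<close>

text \<open>The Leibniz rule for \<open>i\<^sub>X \<Omega> = df - (E \<cdot> f) \<omega>\<close>, where \<open>X\<close> is the lift of \<open>(f, h)\<close>.\<close>

lemma derivative_of_Omega_preham_lift:
  assumes f: "smooth_fun M U f" and Y: "vector_field M U Y" and p: "p \<in> U" and v: "v \<in> tangent M p"
  shows "v (\<lambda>q. \<Omega> q (preham_lift M E \<Lambda> (f, h) q) (Y q))
    = v (\<lambda>q. Y q f) - (E p f * v (\<lambda>q. \<omega> q (Y q)) + \<omega> p (Y p) * v (\<lambda>q. E q f))"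
proof -
  note oU = smooth_fun_openin[OF f]
  have s: "smooth_near M p (\<lambda>q. Y q f)" "smooth_near M p (\<lambda>q. E q f)" "smooth_near M p (\<lambda>q. \<omega> q (Y q))"
    using vector_field_smooth_near[OF Y p smooth_nearI[OF f p]]
      vector_field_smooth_near[OF E_field_on[OF oU] p smooth_nearI[OF f p]]
      smooth_nearI[OF omega_smooth[OF Y] p] .
  note m = smooth_near_mult[OF s(2,3)]
  have "v (\<lambda>q. Y q f - E q f * \<omega> q (Y q)) = v (\<lambda>q. \<Omega> q (preham_lift M E \<Lambda> (f, h) q) (Y q))"
  proof (rule tangent_cong[OF v smooth_near_diff[OF s(1) m] oU p])
    fix q assume q: "q \<in> U"
    then have "q \<in> topspace (mtop M)" using openin_subset[OF oU] by blast
    from Omega_preham_lift[OF this vector_field_tangent[OF Y q]]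
    show "Y q f - E q f * \<omega> q (Y q) = \<Omega> q (preham_lift M E \<Lambda> (f, h) q) (Y q)" by simp
  qed
  then show ?thesis
    using tangent_diff[OF v s(1) m] tangent_mult[OF v s(2,3)] by simp
qed

lemma LGen_smooth:
  assumes "(f, h) \<in> LGen M \<omega> E \<Lambda> U"
  shows "smooth_fun M U f" "smooth_fun M U h"
  using assms by (simp_all add: LGen_def)

lemma LGen_preserves_omega:
  assumes "(f, h) \<in> LGen M \<omega> E \<Lambda> U" "V \<subseteq> U" "vector_field M V Y" "p \<in> V"
  shows "\<omega> p (lie_bracket M (preham_lift M E \<Lambda> (f, h)) Y p) = preham_lift M E \<Lambda> (f, h) p (\<lambda>q. \<omega> q (Y q))"
  using assms LGen_iff by simp

text \<open>Write \<open>e\<^sub>i = E \<cdot> f\<^sub>i\<close> and \<open>Z = [X\<^sub>1, X\<^sub>2]\<close>. As \<open>\<Omega>\<close> is closed, \<open>i\<^sub>Z \<Omega>\<close> is the Lie derivative of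
  \<open>i\<^bsub>X\<^sub>2\<^esub> \<Omega> = df\<^sub>2 - e\<^sub>2 \<omega>\<close> along \<open>X\<^sub>1\<close> minus the contraction with \<open>X\<^sub>2\<close> of
  \<open>d (i\<^bsub>X\<^sub>1\<^esub> \<Omega>) = - de\<^sub>1 \<and> \<omega> - e\<^sub>1 d\<omega>\<close>. Since both fields preserve \<open>\<omega>\<close>, the first is
  \<open>d (X\<^sub>1 \<cdot> f\<^sub>2) - (X\<^sub>1 \<cdot> e\<^sub>2) \<omega>\<close>, and \<open>i\<^bsub>X\<^sub>2\<^esub> d\<omega> = - dh\<^sub>2\<close> turns the second into
  \<open>d (h\<^sub>2 e\<^sub>1) - (X\<^sub>2 \<cdot> e\<^sub>1) \<omega>\<close>. The proof evaluates this on a local field \<open>Y\<close>.\<close>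

lemma Omega_lie_bracket:
  assumes G1: "(f\<^sub>1, h\<^sub>1) \<in> LGen M \<omega> E \<Lambda> U" and G2: "(f\<^sub>2, h\<^sub>2) \<in> LGen M \<omega> E \<Lambda> U"
    and p: "p \<in> U" and u: "u \<in> tangent M p"
  defines "X\<^sub>1 \<equiv> preham_lift M E \<Lambda> (f\<^sub>1, h\<^sub>1)" and "X\<^sub>2 \<equiv> preham_lift M E \<Lambda> (f\<^sub>2, h\<^sub>2)"
  shows "\<Omega> p (lie_bracket M X\<^sub>1 X\<^sub>2 p) u = u (\<lambda>q. X\<^sub>1 q f\<^sub>2 - h\<^sub>2 q * E q f\<^sub>1)
    + (X\<^sub>2 p (\<lambda>q. E q f\<^sub>1) - X\<^sub>1 p (\<lambda>q. E q f\<^sub>2)) * \<omega> p u"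
proof -
  note oU = smooth_fun_openin[OF LGen_smooth(1)[OF G1]]
  obtain V Y where V: "p \<in> V" "V \<subseteq> U" and Y: "vector_field M V Y" and Yp: "Y p = u"
    using tangent_vector_extends[OF p oU u] .
  note oV = vector_field_openin[OF Y]
  have top: "p \<in> topspace (mtop M)" using openin_subset[OF oU] p by blast
  have fh: "smooth_fun M V f\<^sub>1" "smooth_fun M V h\<^sub>1" "smooth_fun M V f\<^sub>2" "smooth_fun M V h\<^sub>2"
    using LGen_smooth[OF G1] LGen_smooth[OF G2] smooth_fun_subset[OF _ oV V(2)] by simp_all
  have X1: "vector_field M V X\<^sub>1" and X2: "vector_field M V X\<^sub>2"
    unfolding X\<^sub>1_def X\<^sub>2_def using preham_lift_vector_field[OF fh(1,2)] preham_lift_vector_field[OF fh(3,4)] .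
  note t1 = vector_field_tangent[OF X1 V(1)] and t2 = vector_field_tangent[OF X2 V(1)]
  note s2 = smooth_nearI[OF fh(3) V(1)] and s1 = smooth_nearI[OF fh(1) V(1)]
  have w2: "u (\<lambda>q. \<omega> q (X\<^sub>2 q)) = u h\<^sub>2"
  proof (rule tangent_cong[OF u smooth_nearI[OF fh(4) V(1)] oV V(1), symmetric])
    show "h\<^sub>2 q = \<omega> q (X\<^sub>2 q)" if "q \<in> V" for q
      unfolding X\<^sub>2_def using openin_subset[OF oV] that by (intro omega_preham_lift[symmetric]) blast
  qed
  have d: "d_two_form M \<Omega> X\<^sub>1 X\<^sub>2 Y p = 0"
    using Omega_closed X1 X2 Y V(1) by (simp add: closed_two_form_def)
  have T: "X\<^sub>1 p (\<lambda>q. \<Omega> q (X\<^sub>2 q) (Y q))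
        = X\<^sub>1 p (\<lambda>q. Y q f\<^sub>2) - (E p f\<^sub>2 * X\<^sub>1 p (\<lambda>q. \<omega> q (Y q)) + \<omega> p u * X\<^sub>1 p (\<lambda>q. E q f\<^sub>2))"
      "X\<^sub>2 p (\<lambda>q. \<Omega> q (X\<^sub>1 q) (Y q))
        = X\<^sub>2 p (\<lambda>q. Y q f\<^sub>1) - (E p f\<^sub>1 * X\<^sub>2 p (\<lambda>q. \<omega> q (Y q)) + \<omega> p u * X\<^sub>2 p (\<lambda>q. E q f\<^sub>1))"
      "u (\<lambda>q. \<Omega> q (X\<^sub>1 q) (X\<^sub>2 q))
        = u (\<lambda>q. X\<^sub>2 q f\<^sub>1) - (E p f\<^sub>1 * u h\<^sub>2 + h\<^sub>2 p * u (\<lambda>q. E q f\<^sub>1))"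
    using derivative_of_Omega_preham_lift[OF fh(3) Y V(1) t1, of h\<^sub>2]
      derivative_of_Omega_preham_lift[OF fh(1) Y V(1) t2, of h\<^sub>1]
      derivative_of_Omega_preham_lift[OF fh(1) X2 V(1) u, of h\<^sub>1]
      omega_preham_lift[OF top, of f\<^sub>2 h\<^sub>2] w2
    unfolding X\<^sub>1_def[symmetric] X\<^sub>2_def[symmetric] Yp by simp_all
  note b1 = lie_bracket_tangent[OF X1 Y V(1)] and b2 = lie_bracket_tangent[OF X2 Y V(1)]
  have "\<Omega> p (lie_bracket M X\<^sub>1 Y p) (X\<^sub>2 p)
      = - (X\<^sub>1 p (\<lambda>q. Y q f\<^sub>2) - u (\<lambda>q. X\<^sub>1 q f\<^sub>2) - E p f\<^sub>2 * X\<^sub>1 p (\<lambda>q. \<omega> q (Y q)))"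
    using Omega_skew[OF top b1 t2] Omega_preham_lift[OF top b1, of f\<^sub>2 h\<^sub>2]
      LGen_preserves_omega[OF G1 V(2) Y V(1)] lie_bracket_apply[OF s2, of X\<^sub>1 Y]
    unfolding X\<^sub>1_def[symmetric] X\<^sub>2_def[symmetric] Yp by simp
  moreover have "\<Omega> p (lie_bracket M X\<^sub>2 Y p) (X\<^sub>1 p)
      = - (X\<^sub>2 p (\<lambda>q. Y q f\<^sub>1) - u (\<lambda>q. X\<^sub>2 q f\<^sub>1) - E p f\<^sub>1 * X\<^sub>2 p (\<lambda>q. \<omega> q (Y q)))"
    using Omega_skew[OF top b2 t1] Omega_preham_lift[OF top b2, of f\<^sub>1 h\<^sub>1]
      LGen_preserves_omega[OF G2 V(2) Y V(1)] lie_bracket_apply[OF s1, of X\<^sub>2 Y]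
    unfolding X\<^sub>1_def[symmetric] X\<^sub>2_def[symmetric] Yp by simp
  moreover have "u (\<lambda>q. X\<^sub>1 q f\<^sub>2 - h\<^sub>2 q * E q f\<^sub>1)
      = u (\<lambda>q. X\<^sub>1 q f\<^sub>2) - (h\<^sub>2 p * u (\<lambda>q. E q f\<^sub>1) + E p f\<^sub>1 * u h\<^sub>2)"
  proof -
    note h = smooth_nearI[OF fh(4) V(1)]
    note e = vector_field_smooth_near[OF E_field_on[OF oV] V(1) s1]
    show ?thesis
      using tangent_diff[OF u vector_field_smooth_near[OF X1 V(1) s2] smooth_near_mult[OF h e]]
        tangent_mult[OF u h e] by simp
  qed
  ultimately show ?thesis
    using d T unfolding d_two_form_def Yp by (simp add: algebra_simps)
qed

text \<open>By the previous lemma the contractions of \<open>\<Omega>\<close> with the two sides differ by a multiple of \<open>\<omega>\<close>.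
  Both contractions vanish on \<open>E\<close>, hence they are equal. The second function is chosen such that \<open>\<omega>\<close> takes the same
  value on the two sides, and a vector is determined by its contractions with \<open>\<omega>\<close> and \<open>\<Omega>\<close>.\<close>

lemma lie_bracket_eq_preham_lift:
  assumes G1: "(f\<^sub>1, h\<^sub>1) \<in> LGen M \<omega> E \<Lambda> U" and G2: "(f\<^sub>2, h\<^sub>2) \<in> LGen M \<omega> E \<Lambda> U" and p: "p \<in> U"
  defines "X\<^sub>1 \<equiv> preham_lift M E \<Lambda> (f\<^sub>1, h\<^sub>1)" and "X\<^sub>2 \<equiv> preham_lift M E \<Lambda> (f\<^sub>2, h\<^sub>2)"
  shows "lie_bracket M X\<^sub>1 X\<^sub>2 p
    = preham_lift M E \<Lambda> (\<lambda>q. X\<^sub>1 q f\<^sub>2 - h\<^sub>2 q * E q f\<^sub>1, \<lambda>q. \<omega> q (lie_bracket M X\<^sub>1 X\<^sub>2 q)) p"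
proof -
  let ?f = "\<lambda>q. X\<^sub>1 q f\<^sub>2 - h\<^sub>2 q * E q f\<^sub>1" and ?h = "\<lambda>q. \<omega> q (lie_bracket M X\<^sub>1 X\<^sub>2 q)"
  let ?Z = "lie_bracket M X\<^sub>1 X\<^sub>2 p" and ?L = "preham_lift M E \<Lambda> (?f, ?h) p"
  let ?w = "\<lambda>g. 1 * ?Z g + (-1) * ?L g"
  have top: "p \<in> topspace (mtop M)"
    using openin_subset[OF smooth_fun_openin[OF LGen_smooth(1)[OF G1]]] p by blast
  have Z: "?Z \<in> tangent M p"
    unfolding X\<^sub>1_def X\<^sub>2_def
    by (rule lie_bracket_tangent[OF preham_lift_vector_field[OF LGen_smooth[OF G1]]
          preham_lift_vector_field[OF LGen_smooth[OF G2]] p])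
  have L: "?L \<in> tangent M p"
    using tangent_combine[OF ham_field_tangent[OF top] E_tangent[OF top], of 1 ?f "?h p"]
    by (simp add: preham_lift_apply)
  define c where "c = X\<^sub>2 p (\<lambda>q. E q f\<^sub>1) - X\<^sub>1 p (\<lambda>q. E q f\<^sub>2)"
  have Om: "\<Omega> p ?Z u = u ?f + c * \<omega> p u" if "u \<in> tangent M p" for u
    using Omega_lie_bracket[OF G1 G2 p that] unfolding X\<^sub>1_def X\<^sub>2_def c_def .
  \<comment> \<open>Evaluation at \<open>E\<close>, where \<open>\<omega>\<close> is 1 and \<open>\<Omega>\<close> is 0.\<close>
  have "c = - E p ?f"
    using Om[OF E_tangent[OF top]] Omega_skew[OF top Z E_tangent[OF top]] Omega_E[OF top Z] omega_E[OF top]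
    by simp
  then have "\<Omega> p ?w u = 0" if u: "u \<in> tangent M p" for u
    using Omega_linear_left[OF top Z L u, of 1 "-1"] Om[OF u] Omega_preham_lift[OF top u, of ?f ?h] by simp
  moreover have "\<omega> p ?w = 0"
    using linear_fiber_lincomb[OF cotangent_linear_fiber[OF omega_cotangent[OF top]] Z L, of 1 "-1"]
      omega_preham_lift[OF top, of ?f ?h] by simp
  ultimately have "?w = (\<lambda>g. 0)"
    using kernel_trivial[OF top tangent_combine[OF Z L]] by blast
  then have "?w g = 0" for g by (rule fun_cong)
  then show ?thesis by (intro ext) simp
qed

text \<open>The Lie derivative along a bracket is the commutator of the Lie derivatives; evaluated on \<open>Y\<close>,
  this is the Jacobi identity.\<close>

lemma bracket_preserves_omega:
  assumes G1: "(f\<^sub>1, h\<^sub>1) \<in> LGen M \<omega> E \<Lambda> U" and G2: "(f\<^sub>2, h\<^sub>2) \<in> LGen M \<omega> E \<Lambda> U"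
    and V: "V \<subseteq> U" "p \<in> V" and Y: "vector_field M V Y"
  defines "X\<^sub>1 \<equiv> preham_lift M E \<Lambda> (f\<^sub>1, h\<^sub>1)" and "X\<^sub>2 \<equiv> preham_lift M E \<Lambda> (f\<^sub>2, h\<^sub>2)"
  shows "lie_bracket M X\<^sub>1 X\<^sub>2 p (\<lambda>q. \<omega> q (Y q)) = \<omega> p (lie_bracket M (lie_bracket M X\<^sub>1 X\<^sub>2) Y p)"
proof -
  note oV = vector_field_openin[OF Y]
  have top: "p \<in> topspace (mtop M)" using openin_subset[OF oV] V by blast
  have X1: "vector_field M V X\<^sub>1" and X2: "vector_field M V X\<^sub>2"
    unfolding X\<^sub>1_def X\<^sub>2_def
    using vector_field_subset[OF preham_lift_vector_field[OF LGen_smooth[OF G1]] oV V(1)]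
      vector_field_subset[OF preham_lift_vector_field[OF LGen_smooth[OF G2]] oV V(1)] .
  note t1 = vector_field_tangent[OF X1 V(2)] and t2 = vector_field_tangent[OF X2 V(2)]
  note F1 = lie_bracket_field[OF X1 Y] and F2 = lie_bracket_field[OF X2 Y]
  have i1: "\<omega> q (lie_bracket M X\<^sub>1 W q) = X\<^sub>1 q (\<lambda>q. \<omega> q (W q))" if "vector_field M V W" "q \<in> V" for W q
    using LGen_preserves_omega[OF G1 V(1) that] unfolding X\<^sub>1_def .
  have i2: "\<omega> q (lie_bracket M X\<^sub>2 W q) = X\<^sub>2 q (\<lambda>q. \<omega> q (W q))" if "vector_field M V W" "q \<in> V" for W q
    using LGen_preserves_omega[OF G2 V(1) that] unfolding X\<^sub>2_def .
  have 1: "X\<^sub>1 p (\<lambda>q. \<omega> q (lie_bracket M X\<^sub>2 Y q)) = X\<^sub>1 p (\<lambda>q. X\<^sub>2 q (\<lambda>r. \<omega> r (Y r)))"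
    by (rule tangent_cong[OF t1 smooth_nearI[OF omega_smooth[OF F2] V(2)] oV V(2)]) (rule i2[OF Y])
  have 2: "X\<^sub>2 p (\<lambda>q. \<omega> q (lie_bracket M X\<^sub>1 Y q)) = X\<^sub>2 p (\<lambda>q. X\<^sub>1 q (\<lambda>r. \<omega> r (Y r)))"
    by (rule tangent_cong[OF t2 smooth_nearI[OF omega_smooth[OF F1] V(2)] oV V(2)]) (rule i1[OF Y])
  have "\<omega> p (lie_bracket M (lie_bracket M X\<^sub>1 X\<^sub>2) Y p)
      = \<omega> p (lie_bracket M X\<^sub>1 (lie_bracket M X\<^sub>2 Y) p) - \<omega> p (lie_bracket M X\<^sub>2 (lie_bracket M X\<^sub>1 Y) p)"
    using linear_fiber_lincomb[OF cotangent_linear_fiber[OF omega_cotangent[OF top]]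
        lie_bracket_tangent[OF X1 F2 V(2)] lie_bracket_tangent[OF X2 F1 V(2)], of 1 "-1"]
    by (simp add: Jacobi_identity[OF X1 X2 Y V(2)])
  also have "\<dots> = lie_bracket M X\<^sub>1 X\<^sub>2 p (\<lambda>q. \<omega> q (Y q))"
    using i1[OF F2 V(2)] i2[OF F1 V(2)] 1 2 lie_bracket_apply[OF smooth_nearI[OF omega_smooth[OF Y] V(2)], of X\<^sub>1 X\<^sub>2]
    by simp
  finally show ?thesis by simp
qed

lemma LGen_bracket_closed:
  assumes G1: "(f\<^sub>1, h\<^sub>1) \<in> LGen M \<omega> E \<Lambda> U" and G2: "(f\<^sub>2, h\<^sub>2) \<in> LGen M \<omega> E \<Lambda> U"
  defines "X\<^sub>1 \<equiv> preham_lift M E \<Lambda> (f\<^sub>1, h\<^sub>1)" and "X\<^sub>2 \<equiv> preham_lift M E \<Lambda> (f\<^sub>2, h\<^sub>2)"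
  shows "(\<lambda>q. X\<^sub>1 q f\<^sub>2 - h\<^sub>2 q * E q f\<^sub>1, \<lambda>q. \<omega> q (lie_bracket M X\<^sub>1 X\<^sub>2 q)) \<in> LGen M \<omega> E \<Lambda> U"
    (is "(?f, ?h) \<in> _")
  unfolding LGen_iff
proof (intro conjI allI impI ballI)
  note s1 = LGen_smooth[OF G1] and s2 = LGen_smooth[OF G2]
  note oU = smooth_fun_openin[OF s1(1)]
  have X1: "vector_field M U X\<^sub>1" and X2: "vector_field M U X\<^sub>2"
    unfolding X\<^sub>1_def X\<^sub>2_def using preham_lift_vector_field[OF s1] preham_lift_vector_field[OF s2] .
  show f: "smooth_fun M U ?f"
    by (intro smooth_fun_diff smooth_fun_mult s2(2) vector_field_smooth_fun[OF X1 s2(1)]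
        vector_field_smooth_fun[OF E_field_on[OF oU] s1(1)]) simp_all
  show h: "smooth_fun M U ?h"
    by (rule omega_smooth[OF lie_bracket_field[OF X1 X2]])
  fix V Y p assume V: "V \<subseteq> U" and Y: "vector_field M V Y" and p: "p \<in> V"
  let ?L = "preham_lift M E \<Lambda> (?f, ?h)"
  note oV = vector_field_openin[OF Y]
  have eq: "lie_bracket M X\<^sub>1 X\<^sub>2 q = ?L q" if "q \<in> U" for q
    using lie_bracket_eq_preham_lift[OF G1 G2 that] unfolding X\<^sub>1_def X\<^sub>2_def .
  have "lie_bracket M ?L Y p = lie_bracket M (lie_bracket M X\<^sub>1 X\<^sub>2) Y p"
    by (rule lie_bracket_cong[OF vector_field_subset[OF lie_bracket_field[OF X1 X2] oV V] Y p, symmetric])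
      (use eq V in blast)
  then show "?L p (\<lambda>q. \<omega> q (Y q)) = \<omega> p (lie_bracket M ?L Y p)"
    using bracket_preserves_omega[OF G1 G2 V p Y] eq[of p] V p unfolding X\<^sub>1_def X\<^sub>2_def by auto
qed

end

theorem theorem2p3:
  fixes M :: "('a, 'b::euclidean_space) charted_space"
    and n :: nat
    and \<omega> :: "'a \<Rightarrow> 'a covec"
    and \<Omega> :: "'a \<Rightarrow> 'a tvec \<Rightarrow> 'a tvec \<Rightarrow> real"
    and E :: "'a \<Rightarrow> 'a tvec"
    and \<Lambda> :: "'a \<Rightarrow> 'a covec \<Rightarrow> 'a covec \<Rightarrow> real"
    and U :: "'a set"
    and f\<^sub>1 h\<^sub>1 f\<^sub>2 h\<^sub>2 :: "'a \<Rightarrow> real"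
  assumes "smooth_manifold M"
    and "DIM('b) = 2 * n + 1"
    and "acc_structure M n \<omega> \<Omega>"
    and "dual_structure M \<omega> \<Omega> E \<Lambda>"
    and "openin (mtop M) U"
    and "(f\<^sub>1, h\<^sub>1) \<in> LGen M \<omega> E \<Lambda> U"
    and "(f\<^sub>2, h\<^sub>2) \<in> LGen M \<omega> E \<Lambda> U"
  shows "\<exists>f h. (f, h) \<in> LGen M \<omega> E \<Lambda> U \<and>
    (\<forall>p\<in>U. lie_bracket M (preham_lift M E \<Lambda> (f\<^sub>1, h\<^sub>1)) (preham_lift M E \<Lambda> (f\<^sub>2, h\<^sub>2)) p
      = preham_lift M E \<Lambda> (f, h) p)"
proof -
  interpret acc_mfd M n \<omega> \<Omega> E \<Lambda>
    using assms(1-4) by unfold_locales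
  show ?thesis
    using LGen_bracket_closed[OF assms(6,7)] lie_bracket_eq_preham_lift[OF assms(6,7)] by blast
qed

end
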